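(* Let $\mathbf y=(y_w)_{w\in\mathcal W}$ be a real-valued quaternionic pseudo-moment sequence. The following are equivalent. (i) There exists a positive Borel measure $\mu$ on $\mathbb H^n$ representing $\mathbf y$. (ii) $L_{\mathbf y}(p)\ge0$ for every $p\in\mathcal P_n^{\mathbb R}$. (iii) $L_{\mathbf y}(\mathcal I_n^{\mathbb R})=0$ and the induced functional $\widetilde L_{\mathbf y}:\mathcal B\to\mathbb R$ is nonnegative on every $b\in\mathcal B$ whose scalar evaluation is nonnegative on $\mathbb H^n$. Moreover, whenever a representing measure exists, one may choose it invariant under simultaneous quaternionic conjugation $(q_1,\dots,q_n)\mapsto(uq_1\bar u,\dots,uq_n\bar u)$ for every $u\in\mathbb H$ with $|u|=1$.
   Context: $\mathbb H$ is the skew field of quaternions, $\mathcal R(a)$ the real part of $a\in\mathbb H$. Fix $n\ge1$ and letters $q_1,\dots,q_n,\bar q_1,\dots,\bar q_n$. $\mathcal W$ is the set of words (including the empty word $1$) in these letters, where words with the same normal form are identified: any consecutive factor $q_i\bar q_i$ or $\bar q_iq_i$ is written $|q_i|^2$ and moved to the front, so each word is uniquely $\prod_i|q_i|^{2\alpha_i}\tilde w$ with $\tilde w$ containing no such factor. $w^*$ is obtained by reversing $w$ and exchanging $q_i\leftrightarrow\bar q_i$. $\mathcal F_n=\mathbb R\langle\mathbf q,\bar{\mathbf q}\rangle$ is the real $*$-algebra of finite sums $\sum_wp_ww$, $p_w\in\mathbb R$, with $p^*=\sum_wp_ww^*$; $\operatorname{Sym}$ denotes elements with $p=p^*$. $p(\mathbf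 a,\bar{\mathbf a})$ is the evaluation $q_i\mapsto a_i,\bar q_i\mapsto\bar a_i$ at $\mathbf a\in\mathbb H^n$. Words $u,v$ are cyclically equivalent, $u\stackrel{\mathrm{cyc}}{\sim}v$, if $u=w_1w_2$, $v=w_2w_1$ for some words $w_1,w_2$. A real-valued sequence $\mathbf y=(y_w)_{w\in\mathcal W}$ is a quaternionic pseudo-moment sequence if $y_w=y_{w^*}$ for all $w$ and $y_u=y_v$ whenever $u\stackrel{\mathrm{cyc}}{\sim}v$. It defines the linear functional $L_{\mathbf y}:\mathcal F_n\to\mathbb R$, $L_{\mathbf y}(\sum_wp_ww)=\sum_wp_wy_w$. A positive Borel measure $\mu$ on $\mathbb H^n$ represents $\mathbf y$ if $y_w=\int_{\mathbb H^n}\mathcal R(w(\mathbf a,\bar{\mathbf a}))\,d\mu(\mathbf a)$ for all $w\in\mathcal W$ (all integrals being finite). $\mathcal P_n^{\mathbb R}=\{p\in\operatorname{Sym}\mathcal F_n: p(\mathbf a,\bar{\mathbf a})\ge0\ \forall\mathbf a\in\mathbb H^n\}$. $\mathcal I_n^{\mathbb R}$ is the two-sided $*$-ideal of all $p\in\mathcal F_n$ vanishing under evaluation at every $\mathbf a\in\mathbb H^n$. $\mathcal A=\mathcal F_n/\mathcal I_n^{\mathbb R}$ and $\mathcal B=\operatorname{Sym}\mathcal A$. If $L_{\mathbf y}(\mathcal I_n^{\mathbb R})=0$, the induced functional is $\widetilde L_{\mathbf y}(b)=L_{\mathbf y}\big(\tfrac{p+p^*}2\big)$ for any $p\in\mathcal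 F_n$ representing $b\in\mathcal B$. *)

theory Defs
  imports "HOL-Analysis.Analysis" "HOL-Analysis.Finite_Function_Topology"
begin

section \<open>Quaternions\<close>

datatype quat = Quat (qre: real) (qim1: real) (qim2: real) (qim3: real)

lemma quat_eq_iff:
  "p = q \<longleftrightarrow> qre p = qre q \<and> qim1 p = qim1 q \<and> qim2 p = qim2 q \<and> qim3 p = qim3 q"
  by (cases p; cases q) auto

instantiation quat :: real_vector
begin

definition "0 = Quat 0 0 0 0"
definition "p + q = Quat (qre p + qre q) (qim1 p + qim1 q) (qim2 p + qim2 q) (qim3 p + qim3 q)"
definition "- p = Quat (- qre p) (- qim1 p) (- qim2 p) (- qim3 p)"
definition "p - q = Quat (qre p - qre q) (qim1 p - qim1 q) (qim2 p - qim2 q) (qim3 p - qim3 q)"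
definition "r *\<^sub>R p = Quat (r * qre p) (r * qim1 p) (r * qim2 p) (r * qim3 p)"

instance
  by standard
    (auto simp: quat_eq_iff zero_quat_def plus_quat_def uminus_quat_def minus_quat_def
      scaleR_quat_def algebra_simps)

end

instantiation quat :: real_inner
begin

definition "inner p q = qre p * qre q + qim1 p * qim1 q + qim2 p * qim2 q + qim3 p * qim3 q"
definition norm_quat_def: "norm (p::quat) = sqrt (inner p p)"
definition sgn_quat_def: "sgn (p::quat) = p /\<^sub>R norm p"
definition dist_quat_def: "dist p (q::quat) = norm (p - q)"
definition uniformity_quat_def:
  "(uniformity :: (quat \<times> quat) filter) = (INF e\<in>{0 <..}. principal {(x, y). dist x y < e})"
definition open_quat_def:
  "open (U :: quat set) \<longleftrightarrow> (\<forall>x\<in>U. eventually (\<lambda>(x', y). x' = x \<longrightarrow> y \<in> U) uniformity)"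

instance
proof
  fix p q s :: quat and r :: real
  show "inner p q = inner q p"
    by (simp add: inner_quat_def mult.commute)
  show "inner (p + q) s = inner p s + inner q s"
    by (simp add: inner_quat_def plus_quat_def algebra_simps)
  show "inner (r *\<^sub>R p) q = r * inner p q"
    by (simp add: inner_quat_def scaleR_quat_def algebra_simps)
  show "0 \<le> inner p p"
    by (simp add: inner_quat_def)
  have "a*a + b*b + c*c + d*d = 0 \<longleftrightarrow> a = 0 \<and> b = 0 \<and> c = 0 \<and> d = 0" for a b c d :: real
    by (smt (verit) mult_eq_0_iff not_real_square_gt_zero)
  then show "inner p p = 0 \<longleftrightarrow> p = 0"
    by (simp add: inner_quat_def quat_eq_iff zero_quat_def)
qed (rule norm_quat_def sgn_quat_def dist_quat_def open_quat_def uniformity_quat_def)+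

end

definition qcnj :: "quat \<Rightarrow> quat" where
  "qcnj p = Quat (qre p) (- qim1 p) (- qim2 p) (- qim3 p)"

instantiation quat :: real_normed_div_algebra
begin

definition "1 = Quat 1 0 0 0"
definition "p * q = Quat
  (qre p * qre q - qim1 p * qim1 q - qim2 p * qim2 q - qim3 p * qim3 q)
  (qre p * qim1 q + qim1 p * qre q + qim2 p * qim3 q - qim3 p * qim2 q)
  (qre p * qim2 q - qim1 p * qim3 q + qim2 p * qre q + qim3 p * qim1 q)
  (qre p * qim3 q + qim1 p * qim2 q - qim2 p * qim1 q + qim3 p * qre q)"
definition "inverse p = qcnj p /\<^sub>R inner p p"
definition "p div (q::quat) = p * inverse q"

instance
proof
  fix p q s :: quat and r :: real
  show "p * q * s = p * (q * s)" "1 * p = p" "p * 1 = p" "(p + q) * s = p * s + q * s"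
    "p * (q + s) = p * q + p * s" "r *\<^sub>R p * q = r *\<^sub>R (p * q)" "p * r *\<^sub>R q = r *\<^sub>R (p * q)"
    by (simp_all add: quat_eq_iff times_quat_def one_quat_def plus_quat_def scaleR_quat_def
        algebra_simps)
  show "(0::quat) \<noteq> 1"
    by (simp add: zero_quat_def one_quat_def)
  show "p div q = p * inverse q"
    by (rule divide_quat_def)
  show "inverse (0::quat) = 0"
    by (simp add: inverse_quat_def)
  have *: "qcnj p * p = inner p p *\<^sub>R 1" "p * qcnj p = inner p p *\<^sub>R 1"
    by (simp_all add: quat_eq_iff times_quat_def one_quat_def qcnj_def inner_quat_def
        scaleR_quat_def)
  have sl: "(r *\<^sub>R p) * q = r *\<^sub>R (p * q)" "p * (r *\<^sub>R q) = r *\<^sub>R (p * q)" for r and p q :: quat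
    by (simp_all add: quat_eq_iff times_quat_def scaleR_quat_def algebra_simps)
  show "p \<noteq> 0 \<Longrightarrow> inverse p * p = 1" "p \<noteq> 0 \<Longrightarrow> p * inverse p = 1"
    by (simp_all add: inverse_quat_def sl * del: inner_eq_zero_iff) simp_all
  show "norm (p * q) = norm p * norm q"
    unfolding norm_quat_def real_sqrt_mult [symmetric]
    by (simp add: inner_quat_def times_quat_def algebra_simps)
qed

end

instantiation quat :: euclidean_space
begin

definition "Basis = {Quat 1 0 0 0, Quat 0 1 0 0, Quat 0 0 1 0, Quat 0 0 0 1}"

instance
proof
  show "(Basis :: quat set) \<noteq> {}" "finite (Basis :: quat set)"
    by (simp_all add: Basis_quat_def)
  show "inner u v = (if u = v then 1 else 0)" if "u \<in> Basis" "v \<in> Basis" for u v :: quat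
    using that unfolding Basis_quat_def by (elim insertE emptyE) (simp_all add: inner_quat_def)
  show "(\<forall>u\<in>Basis. inner p u = 0) \<longleftrightarrow> p = 0" for p :: quat
    by (cases p) (simp add: Basis_quat_def inner_quat_def zero_quat_def)
qed

end

lemmas quat_defs = zero_quat_def one_quat_def plus_quat_def uminus_quat_def minus_quat_def
  scaleR_quat_def times_quat_def qcnj_def inner_quat_def

lemma qcnj_qcnj [simp]: "qcnj (qcnj p) = p"
  and qcnj_0 [simp]: "qcnj 0 = 0"
  and qcnj_1 [simp]: "qcnj 1 = 1"
  and qcnj_add: "qcnj (p + q) = qcnj p + qcnj q"
  and qcnj_scaleR: "qcnj (r *\<^sub>R p) = r *\<^sub>R qcnj p"
  and qcnj_mult: "qcnj (p * q) = qcnj q * qcnj p"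
  by (simp_all add: quat_eq_iff quat_defs algebra_simps)

lemma mult_qcnj: "p * qcnj p = of_real ((norm p)\<^sup>2)"
  and qcnj_mult_self: "qcnj p * p = of_real ((norm p)\<^sup>2)"
  by (simp_all add: quat_eq_iff quat_defs of_real_def norm_quat_def power2_eq_square)

definition quat_nonneg :: "quat \<Rightarrow> bool" where
  "quat_nonneg p \<longleftrightarrow> p \<in> \<real> \<and> 0 \<le> qre p"


section \<open>Words\<close>

datatype 'n qletter = Var 'n | Bar 'n

fun bar :: "'n qletter \<Rightarrow> 'n qletter" where
  "bar (Var i) = Bar i"
| "bar (Bar i) = Var i"

fun idx :: "'n qletter \<Rightarrow> 'n" where
  "idx (Var i) = i"
| "idx (Bar i) = i"

text \<open>
  A pair \<open>(\<alpha>, v)\<close> stands for the word \<open>\<Prod>\<^sub>i |q\<^sub>i|\<^bsup>2 \<alpha>\<^sub>i\<^esup> v\<close>, the exponent \<open>\<alpha>\<^sub>i\<close> being \<open>count \<alpha> i\<close>.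
  If \<open>v\<close> contains no factor \<open>q\<^sub>i bar q\<^sub>i\<close> or \<open>bar q\<^sub>i q\<^sub>i\<close> (predicate \<open>reduced\<close>), then \<open>push x\<close>
  multiplies by the letter \<open>x\<close> on the left and renormalises.
\<close>

fun push :: "'n qletter \<Rightarrow> 'n multiset \<times> 'n qletter list \<Rightarrow> 'n multiset \<times> 'n qletter list" where
  "push x (\<alpha>, []) = (\<alpha>, [x])"
| "push x (\<alpha>, y # v) = (if y = bar x then (add_mset (idx x) \<alpha>, v) else (\<alpha>, x # y # v))"

definition normal_form :: "'n qletter list \<Rightarrow> 'n multiset \<times> 'n qletter list" where
  "normal_form u = foldr push u ({#}, [])"

fun reduced :: "'n qletter list \<Rightarrow> bool" where
  "reduced [] \<longleftrightarrow> True"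
| "reduced [x] \<longleftrightarrow> True"
| "reduced (x # y # v) \<longleftrightarrow> y \<noteq> bar x \<and> reduced (y # v)"

lemma bar_bar [simp]: "bar (bar x) = x"
  by (cases x) auto

lemma idx_bar [simp]: "idx (bar x) = idx x"
  by (cases x) auto

lemma bar_eq_iff: "bar x = y \<longleftrightarrow> x = bar y"
  by auto

lemma reduced_tl: "reduced (x # v) \<Longrightarrow> reduced v"
  by (cases v) auto

lemma reduced_push: "reduced (snd s) \<Longrightarrow> reduced (snd (push x s))"
  by (cases "(x, s)" rule: push.cases) (auto dest: reduced_tl)

lemma reduced_foldr: "reduced (snd s) \<Longrightarrow> reduced (snd (foldr push u s))"
  by (induction u) (auto intro: reduced_push)

lemma reduced_normal_form: "reduced (snd (normal_form u))"
  unfolding normal_form_def by (rule reduced_foldr) simp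

definition shift :: "'n multiset \<Rightarrow> 'n multiset \<times> 'b \<Rightarrow> 'n multiset \<times> 'b" where
  "shift \<beta> s = (\<beta> + fst s, snd s)"

lemma shift_shift: "shift \<alpha> (shift \<beta> s) = shift (\<alpha> + \<beta>) s"
  by (simp add: shift_def add.assoc)

lemma push_shift: "push x (shift \<beta> s) = shift \<beta> (push x s)"
  by (cases "(x, s)" rule: push.cases) (auto simp: shift_def)

lemma foldr_push_shift: "foldr push u (shift \<beta> s) = shift \<beta> (foldr push u s)"
  by (induction u) (auto simp: push_shift)

lemma push_push_bar:
  assumes "reduced (snd s)"
  shows "push x (push (bar x) s) = shift {#idx x#} s"
proof (cases s)
  case (Pair \<alpha> v)
  show ?thesis
  proof (cases v)
    case Nil
    with Pair show ?thesis by (simp add: shift_def)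
  next
    case (Cons y v')
    show ?thesis
    proof (cases "y = x")
      case True
      with Pair Cons assms show ?thesis by (cases v') (auto simp: shift_def)
    next
      case False
      with Pair Cons show ?thesis by (auto simp: shift_def)
    qed
  qed
qed

lemma foldr_push_normal_form:
  assumes "reduced (snd s)"
  shows "foldr push u s = shift (fst (normal_form u)) (foldr push (snd (normal_form u)) s)"
proof (induction u)
  case Nil
  then show ?case by (simp add: normal_form_def shift_def)
next
  case (Cons x u)
  obtain \<alpha> w where nu: "normal_form u = (\<alpha>, w)" by fastforce
  then have n: "normal_form (x # u) = push x (\<alpha>, w)" by (simp add: normal_form_def)
  have *: "foldr push (x # u) s = shift \<alpha> (push x (foldr push w s))"
    using Cons nu by (simp add: push_shift)
  show ?case
  proof (cases "\<exists>w'. w = bar x # w'")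
    case True
    then obtain w' where w: "w = bar x # w'" by blast
    have "push x (foldr push w s) = shift {#idx x#} (foldr push w' s)"
      unfolding w by (simp add: push_push_bar reduced_foldr assms)
    with * n w show ?thesis by (simp add: shift_shift)
  next
    case False
    then have "push x (\<alpha>, w) = (\<alpha>, x # w)" by (cases w) auto
    with * n show ?thesis by simp
  qed
qed

lemma normal_form_append: "normal_form (u @ v) = foldr push u (normal_form v)"
  by (simp add: normal_form_def)

lemma normal_form_append_cong:
  assumes "normal_form u = normal_form u'" "normal_form v = normal_form v'"
  shows "normal_form (u @ v) = normal_form (u' @ v')"
  using assms foldr_push_normal_form[OF reduced_normal_form] by (metis normal_form_append)

lemma normal_form_cancel:
  "normal_form (u @ [x, bar x] @ v) = shift {#idx x#} (normal_form (u @ v))"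
  by (simp add: normal_form_append push_push_bar reduced_normal_form foldr_push_shift
      flip: append.simps)

lemma normal_form_of_reduced: "reduced w \<Longrightarrow> normal_form w = ({#}, w)"
proof (induction w rule: reduced.induct)
  case (3 x y v)
  then have "normal_form (y # v) = ({#}, y # v)" by simp
  with 3 show ?case by (simp add: normal_form_def)
qed (auto simp: normal_form_def)

definition star_list :: "'n qletter list \<Rightarrow> 'n qletter list" where
  "star_list u = rev (map bar u)"

lemma normal_form_star_list:
  "normal_form (star_list u)
    = shift (fst (normal_form u)) (normal_form (star_list (snd (normal_form u))))"
proof (induction u)
  case Nil
  then show ?case by (simp add: normal_form_def shift_def star_list_def)
next
  case (Cons x u)
  obtain \<alpha> w where nu: "normal_form u = (\<alpha>, w)" by fastforce
  then have n: "normal_form (x # u) = push x (\<alpha>, w)" by (simp add: normal_form_def)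
  let ?s = "({#}, [bar x])"
  have *: "normal_form (star_list (x # z)) = foldr push (star_list z) ?s" for z
    by (simp add: star_list_def normal_form_def)
  have act: "foldr push (star_list z) ?s = shift (fst (normal_form (star_list z)))
      (foldr push (snd (normal_form (star_list z))) ?s)" for z
    by (rule foldr_push_normal_form) simp
  have "normal_form (star_list (x # u)) = shift \<alpha> (normal_form (star_list (x # w)))"
    using Cons nu unfolding * act[of u] act[of w] by (simp add: shift_def add.assoc)
  moreover have "shift \<alpha> (normal_form (star_list (x # w))) =
      shift (fst (normal_form (x # u))) (normal_form (star_list (snd (normal_form (x # u)))))"
  proof (cases "\<exists>w'. w = bar x # w'")
    case True
    then obtain w' where w: "w = bar x # w'" by blast
    have "normal_form (star_list (x # w)) = shift {#idx x#} (normal_form (star_list w'))"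
      using normal_form_cancel[of "star_list w'" x "[]"] by (simp add: w star_list_def)
    with n w show ?thesis by (simp add: shift_shift)
  next
    case False
    then have "push x (\<alpha>, w) = (\<alpha>, x # w)" by (cases w) auto
    with n show ?thesis by simp
  qed
  ultimately show ?case by simp
qed

quotient_type 'n qword = "'n qletter list" / "\<lambda>u v. normal_form u = normal_form v"
  by (simp add: equivp_def fun_eq_iff) metis

text \<open>
  The monoid of words is written additively: \<open>0\<close> is the empty word and \<open>u + v\<close> the (noncommutative)
  concatenation \<open>uv\<close>. This is the notation for which the library equips finitely supported
  functions with the convolution product.
\<close>

instantiation qword :: (type) monoid_add
begin

lift_definition zero_qword :: "'a qword" is "[]" .

lift_definition plus_qword :: "'a qword \<Rightarrow> 'a qword \<Rightarrow> 'a qword" is "(@)"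
  by (rule normal_form_append_cong)

instance
  by standard (transfer, simp)+

end

lift_definition word_star :: "'n qword \<Rightarrow> 'n qword" is star_list
  by (metis normal_form_star_list)

lemma word_star_word_star [simp]: "word_star (word_star w) = w"
  by transfer (simp add: star_list_def rev_map comp_def)

lemma word_star_0 [simp]: "word_star 0 = 0"
  by transfer (simp add: star_list_def)

lemma word_star_add: "word_star (u + v) = word_star v + word_star u"
  by transfer (simp add: star_list_def)

primrec letter_eval :: "quat ^ 'n \<Rightarrow> 'n qletter \<Rightarrow> quat" where
  "letter_eval a (Var i) = a $ i"
| "letter_eval a (Bar i) = qcnj (a $ i)"

lemma letter_eval_bar: "letter_eval a x * letter_eval a (bar x) = of_real ((norm (a $ idx x))\<^sup>2)"
  by (cases x) (auto simp: mult_qcnj qcnj_mult_self)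

lemma letter_eval_qcnj: "letter_eval a (bar x) = qcnj (letter_eval a x)"
  by (cases x) auto

definition list_eval :: "quat ^ 'n \<Rightarrow> 'n qletter list \<Rightarrow> quat" where
  "list_eval a u = prod_list (map (letter_eval a) u)"

lemma list_eval_normal_form:
  "list_eval a u = of_real (\<Prod>i\<in>#fst (normal_form u). (norm (a $ i))\<^sup>2)
     * list_eval a (snd (normal_form u))"
proof (induction u)
  case Nil
  then show ?case by (simp add: normal_form_def list_eval_def)
next
  case (Cons x u)
  obtain \<alpha> w where nu: "normal_form u = (\<alpha>, w)" by fastforce
  define r where "r = (\<Prod>i\<in>#\<alpha>. (norm (a $ i))\<^sup>2)"
  have n: "normal_form (x # u) = push x (\<alpha>, w)" using nu by (simp add: normal_form_def)
  have *: "list_eval a (x # u) = of_real r * (letter_eval a x * list_eval a w)"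
    using Cons nu by (simp add: list_eval_def r_def scaleR_conv_of_real[symmetric])
  show ?case
  proof (cases "\<exists>w'. w = bar x # w'")
    case True
    then obtain w' where w: "w = bar x # w'" by blast
    have "letter_eval a x * list_eval a w = of_real ((norm (a $ idx x))\<^sup>2) * list_eval a w'"
      unfolding w list_eval_def by (simp add: mult.assoc[symmetric] letter_eval_bar)
    then have "list_eval a (x # u) = of_real (r * (norm (a $ idx x))\<^sup>2) * list_eval a w'"
      unfolding * by (simp add: mult.assoc)
    with n w show ?thesis
      by (simp add: r_def mult.commute)
  next
    case False
    then have "push x (\<alpha>, w) = (\<alpha>, x # w)" by (cases w) auto
    with * n show ?thesis by (simp add: r_def list_eval_def)
  qed
qed

lift_definition word_eval :: "quat ^ 'n \<Rightarrow> 'n qword \<Rightarrow> quat" is list_eval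
  by (metis list_eval_normal_form)

lemma word_eval_0 [simp]: "word_eval a 0 = 1"
  by transfer (simp add: list_eval_def)

lemma word_eval_add: "word_eval a (u + v) = word_eval a u * word_eval a v"
  by transfer (simp add: list_eval_def)

lemma word_eval_star: "word_eval a (word_star w) = qcnj (word_eval a w)"
proof (transfer)
  fix a :: "quat ^ 'n" and w
  show "list_eval a (star_list w) = qcnj (list_eval a w)"
    by (induction w) (simp_all add: list_eval_def star_list_def qcnj_mult letter_eval_qcnj)
qed

definition cyc_equiv :: "'n qword \<Rightarrow> 'n qword \<Rightarrow> bool" where
  "cyc_equiv u v \<longleftrightarrow> (\<exists>w1 w2. u = w1 + w2 \<and> v = w2 + w1)"


section \<open>The free algebra of quaternionic polynomials\<close>

type_synonym 'n qpoly = "'n qword \<Rightarrow>\<^sub>0 real"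

definition lin_ext :: "('a \<Rightarrow> 'b::real_vector) \<Rightarrow> ('a \<Rightarrow>\<^sub>0 real) \<Rightarrow> 'b" where
  "lin_ext f p = (\<Sum>w\<in>Poly_Mapping.keys p. Poly_Mapping.lookup p w *\<^sub>R f w)"

lemma lookup_scaleR_poly_mapping [simp]:
  "Poly_Mapping.lookup (r *\<^sub>R p) w = r *\<^sub>R Poly_Mapping.lookup p w"
  unfolding scaleR_poly_mapping_def
  by (subst lookup_Abs_poly_mapping) (auto intro: finite_subset[OF _ finite_lookup[of p]])

lemma lin_ext_superset:
  assumes "finite S" "Poly_Mapping.keys p \<subseteq> S"
  shows "lin_ext f p = (\<Sum>w\<in>S. Poly_Mapping.lookup p w *\<^sub>R f w)"
  unfolding lin_ext_def using assms by (intro sum.mono_neutral_left) (auto simp: in_keys_iff)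

lemma linear_lin_ext: "linear (lin_ext f)"
proof
  fix p q :: "'a \<Rightarrow>\<^sub>0 real" and r :: real
  let ?S = "Poly_Mapping.keys p \<union> Poly_Mapping.keys q \<union> Poly_Mapping.keys (p + q)"
  show "lin_ext f (p + q) = lin_ext f p + lin_ext f q"
    by (simp add: lin_ext_superset[of ?S] Un_assoc le_supI1 le_supI2 lookup_add scaleR_add_left
        sum.distrib)
  have "Poly_Mapping.keys (r *\<^sub>R p) \<subseteq> Poly_Mapping.keys p"
    by (auto simp: in_keys_iff)
  then show "lin_ext f (r *\<^sub>R p) = r *\<^sub>R lin_ext f p"
    by (simp add: lin_ext_superset[of "Poly_Mapping.keys p"] scaleR_sum_right)
qed

lemmas lin_ext_add = linear_add[OF linear_lin_ext]
  and lin_ext_diff = linear_diff[OF linear_lin_ext]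
  and lin_ext_neg = linear_neg[OF linear_lin_ext]
  and lin_ext_0 = linear_0[OF linear_lin_ext]
  and lin_ext_scaleR = linear_scale[OF linear_lin_ext]
  and lin_ext_sum = linear_sum[OF linear_lin_ext]

lemma lin_ext_single [simp]: "lin_ext f (Poly_Mapping.single w r) = r *\<^sub>R f w"
  by (auto simp: lin_ext_def)

lemma lin_ext_id: "lin_ext (\<lambda>w. Poly_Mapping.single w 1) p = p"
  by (rule poly_mapping_eqI)
    (simp add: lin_ext_def lookup_sum lookup_single when_def if_distrib sum.delta' in_keys_iff
      cong: if_cong)

lemma linear_eq_lin_ext:
  assumes "linear h"
  shows "h p = lin_ext (\<lambda>w. h (Poly_Mapping.single w 1)) p"
proof -
  have "h p = h (lin_ext (\<lambda>w. Poly_Mapping.single w 1) p)"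
    by (simp add: lin_ext_id)
  also have "\<dots> = lin_ext (\<lambda>w. h (Poly_Mapping.single w 1)) p"
    unfolding lin_ext_def by (simp add: linear_sum[OF assms] linear_scale[OF assms])
  finally show ?thesis .
qed

lemma linear_poly_mapping_ext:
  assumes "linear g" "linear h"
    and "\<And>w. g (Poly_Mapping.single w 1) = h (Poly_Mapping.single w (1::real))"
  shows "g p = h p"
  using linear_eq_lin_ext[OF assms(1), of p] linear_eq_lin_ext[OF assms(2), of p]
  by (simp add: assms(3))

lemma poly_mapping_eq_sum_single:
  "p = (\<Sum>w\<in>Poly_Mapping.keys p. Poly_Mapping.single w (Poly_Mapping.lookup p w))"
  by (rule poly_mapping_eqI)
    (simp add: lookup_sum lookup_single when_def sum.delta' in_keys_iff)

instance poly_mapping :: (monoid_add, real_algebra_1) real_algebra_1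
proof
  fix r :: real and p q :: "'a \<Rightarrow>\<^sub>0 'b"
  let ?c = "Poly_Mapping.single 0 (of_real r) :: 'a \<Rightarrow>\<^sub>0 'b"
  have single: "r *\<^sub>R Poly_Mapping.single w c = Poly_Mapping.single w (r *\<^sub>R c)" for w :: 'a and c :: 'b
    by (rule poly_mapping_eqI) (simp add: lookup_single when_def)
  have s: "r *\<^sub>R p = ?c * p" and t: "r *\<^sub>R p = p * ?c" for p :: "'a \<Rightarrow>\<^sub>0 'b"
    by (subst (1 2) poly_mapping_eq_sum_single[of p],
        simp add: scaleR_sum_right sum_distrib_left sum_distrib_right single mult_single
          of_real_def)+
  show "r *\<^sub>R p * q = r *\<^sub>R (p * q)"
    by (simp add: s mult.assoc)
  show "p * r *\<^sub>R q = r *\<^sub>R (p * q)"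
    by (simp add: t mult.assoc)
qed

definition poly_star :: "'n qpoly \<Rightarrow> 'n qpoly" where
  "poly_star = lin_ext (\<lambda>w. Poly_Mapping.single (word_star w) 1)"

definition poly_eval :: "quat ^ 'n \<Rightarrow> 'n qpoly \<Rightarrow> quat" where
  "poly_eval a = lin_ext (word_eval a)"

definition Sym :: "'n qpoly set" where
  "Sym = {p. poly_star p = p}"

definition nonneg_polys :: "'n::finite qpoly set" where
  "nonneg_polys = {p \<in> Sym. \<forall>a. quat_nonneg (poly_eval a p)}"

definition vanishing_ideal :: "'n::finite qpoly set" where
  "vanishing_ideal = {p. \<forall>a. poly_eval a p = 0}"


lemma linear_poly_star: "linear poly_star"
  and linear_poly_eval: "linear (poly_eval a)"
  unfolding poly_star_def poly_eval_def by (rule linear_lin_ext)+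

lemma poly_star_poly_star [simp]: "poly_star (poly_star p) = p"
  by (rule linear_poly_mapping_ext[of "\<lambda>p. poly_star (poly_star p)" "\<lambda>p. p"])
    (simp_all add: linear_compose[OF linear_poly_star linear_poly_star, unfolded comp_def]
      linear_id[unfolded id_def], simp add: poly_star_def)

lemma linear_qcnj: "linear qcnj"
  by (rule linearI) (simp_all add: qcnj_add qcnj_scaleR)

lemma poly_eval_star: "poly_eval a (poly_star p) = qcnj (poly_eval a p)"
  by (rule linear_poly_mapping_ext)
    (simp_all add: linear_compose[OF linear_poly_star linear_poly_eval, unfolded comp_def]
      linear_compose[OF linear_poly_eval linear_qcnj, unfolded comp_def],
      simp add: poly_star_def poly_eval_def word_eval_star)

lemma poly_eval_1 [simp]: "poly_eval a 1 = 1"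
  by (simp add: poly_eval_def flip: single_one)

lemma poly_eval_mult: "poly_eval a (p * q) = poly_eval a p * poly_eval a q"
proof -
  have l: "linear (\<lambda>p. poly_eval a (p * q))" "linear (\<lambda>p. poly_eval a (q * p))"
      "linear (\<lambda>p. poly_eval a p * b)" "linear (\<lambda>p. b * poly_eval a p)" for q b
    by (rule linearI; simp add: algebra_simps linear_add[OF linear_poly_eval]
        linear_scale[OF linear_poly_eval])+
  have "poly_eval a (Poly_Mapping.single u 1 * q) = poly_eval a (Poly_Mapping.single u 1) * poly_eval a q"
    for u
    by (rule linear_poly_mapping_ext[OF l(2) l(4)])
      (simp add: mult_single poly_eval_def word_eval_add)
  then show ?thesis
    by (rule linear_poly_mapping_ext[OF l(1) l(3)])
qed

lemma poly_star_mult: "poly_star (p * q) = poly_star q * poly_star p"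
proof -
  have l: "linear (\<lambda>p. poly_star (p * q))" "linear (\<lambda>p. poly_star (q * p))"
      "linear (\<lambda>p. poly_star p * b)" "linear (\<lambda>p. b * poly_star p)" for q b :: "'n qpoly"
    by (rule linearI; simp add: algebra_simps linear_add[OF linear_poly_star]
        linear_scale[OF linear_poly_star])+
  have "poly_star (Poly_Mapping.single u 1 * q) = poly_star q * poly_star (Poly_Mapping.single u 1)"
    for u
    by (rule linear_poly_mapping_ext[OF l(2) l(3)])
      (simp add: mult_single poly_star_def word_star_add)
  then show ?thesis
    by (rule linear_poly_mapping_ext[OF l(1) l(4)])
qed

lemma vanishing_ideal_two_sided_star_ideal:
  "0 \<in> vanishing_ideal"
  "p \<in> vanishing_ideal \<Longrightarrow> q \<in> vanishing_ideal \<Longrightarrow> p + q \<in> vanishing_ideal"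
  "p \<in> vanishing_ideal \<Longrightarrow> p * q \<in> vanishing_ideal"
  "p \<in> vanishing_ideal \<Longrightarrow> q * p \<in> vanishing_ideal"
  "p \<in> vanishing_ideal \<Longrightarrow> r *\<^sub>R p \<in> vanishing_ideal"
  "p \<in> vanishing_ideal \<Longrightarrow> poly_star p \<in> vanishing_ideal"
  by (simp_all add: vanishing_ideal_def poly_eval_mult poly_eval_star
      linear_0[OF linear_poly_eval] linear_add[OF linear_poly_eval] linear_scale[OF linear_poly_eval])

lemma diff_mem_vanishing_ideal_iff:
  "p - q \<in> vanishing_ideal \<longleftrightarrow> (\<forall>a. poly_eval a p = poly_eval a q)"
  by (simp add: vanishing_ideal_def linear_diff[OF linear_poly_eval])


section \<open>The quotient algebra\<close>

quotient_type 'n scalar_alg = "'n::finite qpoly" / "\<lambda>p q. p - q \<in> vanishing_ideal"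
  by (rule equivpI; auto simp: reflp_def symp_def transp_def diff_mem_vanishing_ideal_iff)

lift_definition alg_eval :: "quat ^ 'n \<Rightarrow> 'n::finite scalar_alg \<Rightarrow> quat" is poly_eval
  by (simp add: diff_mem_vanishing_ideal_iff)

lift_definition alg_star :: "'n::finite scalar_alg \<Rightarrow> 'n scalar_alg" is poly_star
  by (simp add: diff_mem_vanishing_ideal_iff poly_eval_star)

lemma alg_eval_ext: "(\<And>a. alg_eval a b = alg_eval a c) \<Longrightarrow> b = c"
  by (induction b rule: scalar_alg.abs_induct, induction c rule: scalar_alg.abs_induct)
    (simp add: alg_eval.abs_eq scalar_alg.abs_eq_iff diff_mem_vanishing_ideal_iff)

instantiation scalar_alg :: (finite) "{zero, one, plus, minus, uminus, times, scaleR}"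
begin

context
  notes [simp] = diff_mem_vanishing_ideal_iff poly_eval_mult linear_0[OF linear_poly_eval]
    linear_add[OF linear_poly_eval] linear_diff[OF linear_poly_eval]
    linear_neg[OF linear_poly_eval] linear_scale[OF linear_poly_eval]
begin

lift_definition zero_scalar_alg :: "'a scalar_alg" is 0 .
lift_definition one_scalar_alg :: "'a scalar_alg" is 1 .
lift_definition plus_scalar_alg :: "'a scalar_alg \<Rightarrow> 'a scalar_alg \<Rightarrow> 'a scalar_alg" is "(+)" by simp
lift_definition minus_scalar_alg :: "'a scalar_alg \<Rightarrow> 'a scalar_alg \<Rightarrow> 'a scalar_alg" is "(-)" by simp
lift_definition uminus_scalar_alg :: "'a scalar_alg \<Rightarrow> 'a scalar_alg" is uminus by simp
lift_definition times_scalar_alg :: "'a scalar_alg \<Rightarrow> 'a scalar_alg \<Rightarrow> 'a scalar_alg" is "(*)" by simp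
lift_definition scaleR_scalar_alg :: "real \<Rightarrow> 'a scalar_alg \<Rightarrow> 'a scalar_alg" is scaleR by simp

end

instance ..

end

context
  notes [simp] = poly_eval_mult linear_0[OF linear_poly_eval]
    linear_add[OF linear_poly_eval] linear_diff[OF linear_poly_eval]
    linear_neg[OF linear_poly_eval] linear_scale[OF linear_poly_eval]
begin

lemma alg_eval_zero: "alg_eval a 0 = 0"
  and alg_eval_one: "alg_eval a 1 = 1"
  by (simp_all add: zero_scalar_alg.abs_eq one_scalar_alg.abs_eq alg_eval.abs_eq)

lemma alg_eval_uminus: "alg_eval a (- b) = - alg_eval a b"
  and alg_eval_scaleR: "alg_eval a (r *\<^sub>R b) = r *\<^sub>R alg_eval a b"
  by (induction b rule: scalar_alg.abs_induct;
      simp add: uminus_scalar_alg.abs_eq scaleR_scalar_alg.abs_eq alg_eval.abs_eq)+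

lemma alg_eval_plus: "alg_eval a (b + c) = alg_eval a b + alg_eval a c"
  and alg_eval_minus: "alg_eval a (b - c) = alg_eval a b - alg_eval a c"
  and alg_eval_times: "alg_eval a (b * c) = alg_eval a b * alg_eval a c"
  by (induction b rule: scalar_alg.abs_induct, induction c rule: scalar_alg.abs_induct;
      simp add: plus_scalar_alg.abs_eq minus_scalar_alg.abs_eq times_scalar_alg.abs_eq
        alg_eval.abs_eq)+

end

instance scalar_alg :: (finite) real_algebra_1
proof
  show "(0 :: 'a scalar_alg) \<noteq> 1"
    using alg_eval_zero alg_eval_one by (metis zero_neq_one)
qed (rule alg_eval_ext; simp add: alg_eval_zero alg_eval_one alg_eval_uminus alg_eval_scaleR
    alg_eval_plus alg_eval_minus alg_eval_times algebra_simps)+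

definition alg_class :: "'n::finite qpoly \<Rightarrow> 'n scalar_alg" where
  "alg_class = abs_scalar_alg"

definition Sym_alg :: "'n::finite scalar_alg set" where
  "Sym_alg = {b. alg_star b = b}"


section \<open>Pseudo-moment sequences\<close>

definition pseudo_moment_seq :: "('n qword \<Rightarrow> real) \<Rightarrow> bool" where
  "pseudo_moment_seq y \<longleftrightarrow>
     (\<forall>w. y w = y (word_star w)) \<and> (\<forall>u v. cyc_equiv u v \<longrightarrow> y u = y v)"

definition riesz :: "('n qword \<Rightarrow> real) \<Rightarrow> 'n qpoly \<Rightarrow> real" where
  "riesz y = lin_ext y"

text \<open>
  The induced functional picks the representative \<open>p\<close> of \<open>b\<close> by choice; \<open>induced_riesz_alg_class\<close>
  shows that the choice is immaterial once \<open>riesz y\<close> vanishes on \<open>vanishing_ideal\<close>.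
\<close>

definition induced_riesz :: "('n::finite qword \<Rightarrow> real) \<Rightarrow> 'n scalar_alg \<Rightarrow> real" where
  "induced_riesz y b = (let p = (SOME p. alg_class p = b) in riesz y ((1 / 2) *\<^sub>R (p + poly_star p)))"

lemma alg_class_eq_iff: "alg_class p = alg_class q \<longleftrightarrow> p - q \<in> vanishing_ideal"
  by (simp add: alg_class_def scalar_alg.abs_eq_iff)

lemma induced_riesz_alg_class:
  assumes "\<forall>p\<in>vanishing_ideal. riesz y p = 0"
  shows "induced_riesz y (alg_class p) = riesz y ((1 / 2) *\<^sub>R (p + poly_star p))"
proof -
  define q where "q = (SOME q. alg_class q = alg_class p)"
  have "alg_class q = alg_class p"
    unfolding q_def by (rule someI) (rule refl)
  then have "q - p \<in> vanishing_ideal"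
    by (simp add: alg_class_eq_iff)
  then have "(1 / 2) *\<^sub>R ((q - p) + poly_star (q - p)) \<in> vanishing_ideal"
    by (intro vanishing_ideal_two_sided_star_ideal)
  also have "(1 / 2) *\<^sub>R ((q - p) + poly_star (q - p))
      = (1 / 2) *\<^sub>R (q + poly_star q) - (1 / 2) *\<^sub>R (p + poly_star p)"
    by (simp add: linear_diff[OF linear_poly_star] algebra_simps)
  finally have "riesz y ((1 / 2) *\<^sub>R (q + poly_star q) - (1 / 2) *\<^sub>R (p + poly_star p)) = 0"
    using assms by blast
  then show ?thesis
    by (simp add: induced_riesz_def Let_def riesz_def lin_ext_diff flip: q_def)
qed


section \<open>Representing measures\<close>

definition represents :: "(quat ^ 'n) measure \<Rightarrow> ('n::finite qword \<Rightarrow> real) \<Rightarrow> bool" where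
  "represents \<mu> y \<longleftrightarrow> sets \<mu> = sets borel \<and>
     (\<forall>w. integrable \<mu> (\<lambda>a. qre (word_eval a w)) \<and> y w = (\<integral>a. qre (word_eval a w) \<partial>\<mu>))"

definition quat_conj :: "quat \<Rightarrow> quat ^ 'n \<Rightarrow> quat ^ 'n" where
  "quat_conj u a = (\<chi> i. u * a $ i * qcnj u)"

definition conj_invariant :: "(quat ^ 'n) measure \<Rightarrow> bool" where
  "conj_invariant \<mu> \<longleftrightarrow> (\<forall>u. norm u = 1 \<longrightarrow> distr \<mu> borel (quat_conj u) = \<mu>)"

text \<open>
  \<open>distr\<close> is the push-forward only for measurable maps.
\<close>

lemma quat_conj_measurable: "quat_conj u \<in> borel_measurable borel"
proof (rule borel_measurable_continuous_onI)
  have "bounded_linear (\<lambda>a::quat. u * a * qcnj u)"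
    using bounded_linear_compose[OF bounded_linear_mult_left[of "qcnj u"] bounded_linear_mult_right[of u]]
    by simp
  then show "continuous_on UNIV (quat_conj u)"
    unfolding quat_conj_def
    by (intro continuous_intros bounded_linear.continuous_on[of "\<lambda>a. u * a * qcnj u"]) auto
qed

end

theory Submission
  imports Defs "HOL-Probability.Probability"
begin

text \<open>
  A pseudo-moment sequence only sees the real parts \<open>a \<mapsto> \<R>(p(a))\<close>, because the symmetric part of \<open>p\<close>
  evaluates to \<open>\<R>(p(a))\<close>. These functions are polynomials on \<open>H\<^sup>n\<close> that contain the constants and
  \<open>\<Sum>\<^sub>i |q\<^sub>i|\<^sup>2\<close> and are closed under products, so each of them is dominated by another one growing
  faster by the factor \<open>1 + |a|\<^sup>2\<close>. This is what Haviland's argument needs: extend the functional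
  positively to all dominated functions, represent the extension by a measure on the compactly supported
  continuous functions, and use domination to recover the integrals of the polynomials.

  The representing measure comes from the real line: a compact set is coded by a bounded real-valued
  map with a continuous decoder, and on the line Helly's selection theorem turns the functional
  into a distribution. For the invariance, average over the direction of a vector
  that is uniform in the unit ball of \<open>H\<close>; every \<open>\<R>(w(a))\<close> is unchanged by simultaneous conjugation.
\<close>

section \<open>Extension of positive functionals\<close>

text \<open>
  A partially defined positive functional is represented by its graph. Functionality need not be
  required: it follows from linearity and positivity (\<open>positive_graph_unique\<close>).
\<close>

definition positive_graph :: "(('a \<Rightarrow> real) \<times> real) set \<Rightarrow> bool" where
  "positive_graph G \<longleftrightarrow>
     (\<forall>f r g s a b. (f, r) \<in> G \<longrightarrow> (g, s) \<in> G \<longrightarrow> ((\<lambda>x. a * f x + b * g x), a * r + b * s) \<in> G)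
     \<and> (\<forall>f r. (f, r) \<in> G \<longrightarrow> (\<forall>x. 0 \<le> f x) \<longrightarrow> 0 \<le> r)"

lemma positive_graph_comb:
  assumes "positive_graph G" "(f, r) \<in> G" "(g, s) \<in> G"
    "\<And>x. h x = a * f x + b * g x" "t = a * r + b * s"
  shows "(h, t) \<in> G"
proof -
  have "h = (\<lambda>x. a * f x + b * g x)"
    using assms(4) by blast
  then show ?thesis
    using assms(1,2,3,5) unfolding positive_graph_def by simp
qed

lemma positive_graph_mono:
  assumes "positive_graph G" "(f, r) \<in> G" "(g, s) \<in> G" "\<And>x. f x \<le> g x"
  shows "r \<le> s"
proof -
  have "((\<lambda>x. g x - f x), s - r) \<in> G"
    by (rule positive_graph_comb[OF assms(1,3,2), of _ 1 "- 1"]) simp_all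
  moreover have "\<forall>x. 0 \<le> g x - f x"
    using assms(4) by simp
  ultimately have "0 \<le> s - r"
    using assms(1) unfolding positive_graph_def by blast
  then show ?thesis by simp
qed

lemma positive_graph_unique:
  assumes "positive_graph G" "(f, r) \<in> G" "(f, s) \<in> G"
  shows "r = s"
  using positive_graph_mono[OF assms] positive_graph_mono[OF assms(1,3,2)] by simp

text \<open>The one-dimensional step of the Hahn-Banach argument: positivity survives if
  \<open>f\<close> gets any value between those of its minorants and those of its majorants in
  \<open>G\<close>. The functions \<open>- v\<close> and \<open>v\<close> supply one of each, so the
  supremum \<open>c\<close> is finite.\<close>

lemma positive_graph_extend:
  assumes G: "positive_graph G" and v: "(v, r) \<in> G" "\<And>x. \<bar>f x\<bar> \<le> v x"
  obtains G' c where "positive_graph G'" "G \<subseteq> G'" "(f, c) \<in> G'"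
proof -
  define c where "c = Sup {s. \<exists>g. (g, s) \<in> G \<and> (\<forall>x. g x \<le> f x)}"
  have m: "((\<lambda>x. - v x), - r) \<in> G"
    by (rule positive_graph_comb[OF G v(1) v(1), of _ "-1" 0]) simp_all
  have ne: "- r \<in> {s. \<exists>g. (g, s) \<in> G \<and> (\<forall>x. g x \<le> f x)}"
    using m v(2) by (smt (verit) mem_Collect_eq)
  have up: "s \<le> t" if "(g, s) \<in> G" "\<forall>x. g x \<le> f x" "(h, t) \<in> G" "\<forall>x. f x \<le> h x" for g s h t
    using positive_graph_mono[OF G that(1,3)] that by (meson order_trans)
  have bdd: "bdd_above {s. \<exists>g. (g, s) \<in> G \<and> (\<forall>x. g x \<le> f x)}"
    using v up[OF _ _ v(1)] by (intro bdd_aboveI[of _ r]) (auto simp: abs_le_iff)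
  have lo: "s \<le> c" if "(g, s) \<in> G" "\<forall>x. g x \<le> f x" for g s
    unfolding c_def using that bdd by (intro cSup_upper) auto
  have hi: "c \<le> t" if "(h, t) \<in> G" "\<forall>x. f x \<le> h x" for h t
    unfolding c_def using that ne by (intro cSup_least) (blast, use up in blast)
  \<comment> \<open>If \<open>f\<close> already has a value in \<open>G\<close>, then that value is
    both a minorant's and a majorant's and so equals \<open>c\<close>; this case is therefore
    treated together with the others.\<close>
  define G' where "G' = {((\<lambda>x. g x + a * f x), s + a * c) | g s a. (g, s) \<in> G}"
  have G'I: "((\<lambda>x. g x + a * f x), s + a * c) \<in> G'" if "(g, s) \<in> G" for g s a
    unfolding G'_def using that by (intro CollectI exI[of _ g] exI[of _ s] exI[of _ a] conjI refl)
  have "positive_graph G'"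
    unfolding positive_graph_def
  proof (intro conjI allI impI)
    fix f1 r1 f2 r2 and a b :: real
    assume "(f1, r1) \<in> G'" "(f2, r2) \<in> G'"
    then obtain g1 s1 a1 g2 s2 a2 where
      *: "f1 = (\<lambda>x. g1 x + a1 * f x)" "r1 = s1 + a1 * c" "(g1, s1) \<in> G"
         "f2 = (\<lambda>x. g2 x + a2 * f x)" "r2 = s2 + a2 * c" "(g2, s2) \<in> G"
      unfolding G'_def by blast
    have "((\<lambda>x. a * g1 x + b * g2 x), a * s1 + b * s2) \<in> G"
      by (rule positive_graph_comb[OF G *(3,6)]) simp_all
    then have "((\<lambda>x. (a * g1 x + b * g2 x) + (a * a1 + b * a2) * f x),
        (a * s1 + b * s2) + (a * a1 + b * a2) * c) \<in> G'"
      by (rule G'I)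
    then show "((\<lambda>x. a * f1 x + b * f2 x), a * r1 + b * r2) \<in> G'"
      by (simp add: * algebra_simps)
  next
    fix h t assume "(h, t) \<in> G'" and pos: "\<forall>x. 0 \<le> h x"
    then obtain g s a where *: "h = (\<lambda>x. g x + a * f x)" "t = s + a * c" "(g, s) \<in> G"
      unfolding G'_def by blast
    \<comment> \<open>For \<open>a \<noteq> 0\<close>, nonnegativity of \<open>g + a f\<close>
      compares \<open>f\<close> with \<open>- g / a\<close>, which is a minorant of \<open>f\<close>
      if \<open>a > 0\<close> and a majorant if \<open>a < 0\<close>. The value of
      \<open>- g / a\<close> is then on the matching side of \<open>c\<close>.\<close>
    have q: "((\<lambda>x. (- 1 / a) * g x), (- 1 / a) * s) \<in> G"
      by (rule positive_graph_comb[OF G *(3,3), of _ "-1/a" 0]) simp_all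
    have h: "0 \<le> g x + a * f x" for x
      using pos * by simp
    have d: "f x = (- 1 / a) * g x + (g x + a * f x) / a" if "a \<noteq> 0" for x
      using that by (simp add: field_simps)
    consider "a = 0" | "a > 0" | "a < 0" by linarith
    then show "0 \<le> t"
    proof cases
      case 1
      then show ?thesis
        using h * G unfolding positive_graph_def by auto
    next
      case 2
      have "(- 1 / a) * g x \<le> f x" for x
        using d[of x] divide_nonneg_pos[OF h[of x] 2] 2 by linarith
      then have "(- 1 / a) * s \<le> c"
        by (intro lo[OF q] allI)
      then show ?thesis using 2 by (simp add: * field_simps)
    next
      case 3
      have "f x \<le> (- 1 / a) * g x" for x
        using d[of x] divide_nonneg_neg[OF h[of x] 3] 3 by linarith
      then have "c \<le> (- 1 / a) * s"
        by (intro hi[OF q] allI)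
      then show ?thesis using 3 by (simp add: * field_simps)
    qed
  qed
  moreover have "G \<subseteq> G'"
  proof clarify
    fix g s assume "(g, s) \<in> G"
    then have "((\<lambda>x. g x + 0 * f x), s + 0 * c) \<in> G'" by (rule G'I)
    then show "(g, s) \<in> G'" by simp
  qed
  moreover have "(f, c) \<in> G'"
  proof -
    have "((\<lambda>x. 0), 0) \<in> G"
      by (rule positive_graph_comb[OF G v(1) v(1), of _ 0 0]) simp_all
    then have "((\<lambda>x. 0 + 1 * f x), 0 + 1 * c) \<in> G'" by (rule G'I)
    then show ?thesis by simp
  qed
  ultimately show ?thesis by (rule that)
qed

lemma positive_graph_Union:
  assumes "subset.chain (Collect positive_graph) C"
  shows "positive_graph (\<Union>C)"
  unfolding positive_graph_def
proof (intro conjI allI impI)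
  have pos: "positive_graph X" if "X \<in> C" for X
    using assms that by (auto simp: subset.chain_def)
  have tot: "X \<subseteq> Y \<or> Y \<subseteq> X" if "X \<in> C" "Y \<in> C" for X Y
    using assms that by (auto simp: subset.chain_def)
  {
    fix f r g s and a b :: real
    assume "(f, r) \<in> \<Union>C" "(g, s) \<in> \<Union>C"
    then obtain X Y where "X \<in> C" "(f, r) \<in> X" "Y \<in> C" "(g, s) \<in> Y" by blast
    then obtain Z where Z: "Z \<in> C" "(f, r) \<in> Z" "(g, s) \<in> Z"
      using tot by blast
    show "((\<lambda>x. a * f x + b * g x), a * r + b * s) \<in> \<Union>C"
      using positive_graph_comb[OF pos[OF Z(1)] Z(2,3) refl refl] Z(1) by (rule UnionI[rotated])
  next
    fix f r assume "(f, r) \<in> \<Union>C" "\<forall>x. 0 \<le> f x"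
    then show "0 \<le> r" using pos unfolding positive_graph_def by blast
  }
qed

text \<open>Zorn's lemma gives a maximal positive graph above that of \<open>L\<close>, and by the
  one-dimensional step a maximal one reaches every dominated function. Elsewhere
  \<open>\<Lambda>\<close> has arbitrary values, so linearity and positivity are stated for
  dominated arguments.\<close>

theorem M_Riesz_extension:
  fixes e :: "'p::real_vector \<Rightarrow> 'a \<Rightarrow> real" and L :: "'p \<Rightarrow> real"
  assumes e: "\<And>x. linear (\<lambda>p. e p x)" and L: "linear L"
    and pos: "\<And>p. (\<And>x. 0 \<le> e p x) \<Longrightarrow> 0 \<le> L p"
  obtains \<Lambda> where "\<And>p. \<Lambda> (e p) = L p"
    "\<And>f g p q a b. (\<And>x. \<bar>f x\<bar> \<le> e p x) \<Longrightarrow> (\<And>x. \<bar>g x\<bar> \<le> e q x) \<Longrightarrow>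
       \<Lambda> (\<lambda>x. a * f x + b * g x) = a * \<Lambda> f + b * \<Lambda> g"
    "\<And>f p. (\<And>x. \<bar>f x\<bar> \<le> e p x) \<Longrightarrow> (\<And>x. 0 \<le> f x) \<Longrightarrow> 0 \<le> \<Lambda> f"
proof -
  \<comment> \<open>If \<open>e p = e q\<close>, then positivity applied to \<open>p - q\<close> and
    \<open>q - p\<close> gives \<open>L p = L q\<close>, so \<open>G0\<close> is the graph of a
    function.\<close>
  define G0 where "G0 = {(e p, L p) | p. True}"
  have comb: "e (a *\<^sub>R p + b *\<^sub>R q) = (\<lambda>x. a * e p x + b * e q x)" for a b p q
    using linear_add[OF e] linear_scale[OF e] by (simp add: fun_eq_iff)
  have G0: "positive_graph G0"
    unfolding positive_graph_def
  proof (intro conjI allI impI)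
    fix f r g s and a b :: real
    assume "(f, r) \<in> G0" "(g, s) \<in> G0"
    then obtain p q where "f = e p" "r = L p" "g = e q" "s = L q" unfolding G0_def by blast
    then have "((\<lambda>x. a * f x + b * g x), a * r + b * s) = (e (a *\<^sub>R p + b *\<^sub>R q), L (a *\<^sub>R p + b *\<^sub>R q))"
      by (simp add: comb linear_add[OF L] linear_scale[OF L])
    then show "((\<lambda>x. a * f x + b * g x), a * r + b * s) \<in> G0"
      unfolding G0_def by auto
  qed (use pos in \<open>auto simp: G0_def\<close>)
  let ?A = "{G. positive_graph G \<and> G0 \<subseteq> G}"
  have "\<exists>M\<in>?A. \<forall>X\<in>?A. M \<subseteq> X \<longrightarrow> X = M"
  proof (rule subset_Zorn_nonempty)
    show "?A \<noteq> {}" using G0 by blast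
    fix C assume "C \<noteq> {}" and C: "subset.chain ?A C"
    then have "subset.chain (Collect positive_graph) C"
      by (auto simp: subset.chain_def)
    then show "\<Union>C \<in> ?A"
      using positive_graph_Union \<open>C \<noteq> {}\<close> C by (auto simp: subset.chain_def)
  qed
  then obtain M where MA: "M \<in> ?A" and max': "\<forall>X\<in>?A. M \<subseteq> X \<longrightarrow> X = M"
    by (rule bexE)
  then have M: "positive_graph M" "G0 \<subseteq> M"
    by simp_all
  have max: "X = M" if "positive_graph X" "M \<subseteq> X" for X
    using max' that order_trans[OF M(2) that(2)] by simp
  have dom: "\<exists>r. (f, r) \<in> M" if f: "\<And>x. \<bar>f x\<bar> \<le> e p x" for f p
  proof -
    have "(e p, L p) \<in> M" using M(2) unfolding G0_def by blast
    then obtain X c where "positive_graph X" "M \<subseteq> X" "(f, c) \<in> X"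
      using positive_graph_extend[of M "e p" "L p" f] M(1) f by metis
    then show ?thesis
      using max[of X] by blast
  qed
  define \<Lambda> where "\<Lambda> f = (THE r. (f, r) \<in> M)" for f
  have eq: "\<Lambda> f = r" if "(f, r) \<in> M" for f r
    unfolding \<Lambda>_def by (rule the_equality, rule that, erule positive_graph_unique[OF M(1) _ that])
  show ?thesis
  proof (rule that)
    show "\<Lambda> (e p) = L p" for p
      using M(2) by (intro eq) (auto simp: G0_def)
    show "\<Lambda> (\<lambda>x. a * f x + b * g x) = a * \<Lambda> f + b * \<Lambda> g"
      if fg: "\<And>x. \<bar>f x\<bar> \<le> e p x" "\<And>x. \<bar>g x\<bar> \<le> e q x" for f g p q a b
    proof -
      obtain r s where rs: "(f, r) \<in> M" "(g, s) \<in> M"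
        using dom[of f, OF fg(1)] dom[of g, OF fg(2)] by blast
      show ?thesis
        unfolding eq[OF rs(1)] eq[OF rs(2)]
        by (rule eq, rule positive_graph_comb[OF M(1) rs refl refl])
    qed
    show "0 \<le> \<Lambda> f" if f: "\<And>x. \<bar>f x\<bar> \<le> e p x" "\<And>x. 0 \<le> f x" for f p
    proof -
      obtain r where r: "(f, r) \<in> M"
        using dom[of f, OF f(1)] by blast
      then have "0 \<le> r"
        using M(1) f(2) unfolding positive_graph_def by blast
      then show ?thesis
        by (simp add: eq[OF r])
    qed
  qed
qed

section \<open>Coding a compact set by real numbers\<close>

text \<open>The leading term has size \<open>(1 / 3) ^ n\<close>, and the tail after it sums to at
  most half of that. This gap is why the base is 3: in base 2 a tail could cancel the leading
  term.\<close>

lemma abs_suminf_digits_ge: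
  fixes c :: "nat \<Rightarrow> real"
  assumes c: "\<And>k. \<bar>c k\<bar> \<le> 1" and n: "\<And>k. k < n \<Longrightarrow> c k = 0" "\<bar>c n\<bar> = 1"
  shows "(1 / 3) ^ n / 2 \<le> \<bar>suminf (\<lambda>k. c k * (1 / 3) ^ k)\<bar>"
proof -
  have geo: "summable (\<lambda>k. (1 / 3 :: real) ^ k)" "suminf (\<lambda>k. (1 / 3 :: real) ^ k) = 3 / 2"
    using suminf_geometric[of "1/3 :: real"] by (auto intro: summable_geometric)
  have s: "summable (\<lambda>k. \<bar>c k * (1 / 3) ^ k\<bar>)"
    by (rule summable_comparison_test'[OF geo(1)])
      (use c in \<open>auto simp: abs_mult power_abs intro!: mult_left_le_one_le\<close>)
  have s': "summable (\<lambda>k. c k * (1 / 3) ^ k)"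
    using s by (rule summable_rabs_cancel)
  have tail: "summable (\<lambda>k. \<bar>c (k + Suc n) * (1 / 3) ^ (k + Suc n)\<bar>)"
    using summable_ignore_initial_segment[OF s, of "Suc n"] .
  have "suminf (\<lambda>k. c k * (1 / 3) ^ k) = suminf (\<lambda>k. c (k + Suc n) * (1 / 3) ^ (k + Suc n)) + (\<Sum>k<Suc n. c k * (1 / 3) ^ k)"
    by (rule suminf_split_initial_segment[OF s'])
  also have "(\<Sum>k<Suc n. c k * (1 / 3) ^ k) = c n * (1 / 3) ^ n"
    using n(1) by simp
  finally have eq: "suminf (\<lambda>k. c k * (1 / 3) ^ k) = suminf (\<lambda>k. c (k + Suc n) * (1 / 3) ^ (k + Suc n)) + c n * (1 / 3) ^ n" .
  have "\<bar>suminf (\<lambda>k. c (k + Suc n) * (1 / 3) ^ (k + Suc n))\<bar> \<le> suminf (\<lambda>k. \<bar>c (k + Suc n) * (1 / 3) ^ (k + Suc n)\<bar>)"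
    by (rule summable_rabs[OF tail])
  also have "\<dots> \<le> suminf (\<lambda>k. (1 / 3) ^ Suc n * (1 / 3) ^ k)"
  proof (rule suminf_le[OF _ tail])
    show "summable (\<lambda>k. (1 / 3 :: real) ^ Suc n * (1 / 3) ^ k)"
      by (intro summable_mult geo)
    show "\<bar>c (k + Suc n) * (1 / 3) ^ (k + Suc n)\<bar> \<le> (1 / 3) ^ Suc n * (1 / 3) ^ k" for k
      using mult_right_mono[OF c[of "k + Suc n"], of "(1 / 3) ^ (k + Suc n)"]
      by (simp add: abs_mult power_add mult_ac)
  qed
  also have "\<dots> = (1 / 3) ^ n / 2"
    using suminf_mult[OF geo(1), of "(1 / 3) ^ Suc n"] geo(2) by simp
  finally have "\<bar>suminf (\<lambda>k. c (k + Suc n) * (1 / 3) ^ (k + Suc n))\<bar> \<le> (1 / 3) ^ n / 2" .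
  moreover have "\<bar>c n * (1 / 3) ^ n\<bar> = (1 / 3) ^ n"
    using n(2) by (simp add: abs_mult)
  ultimately show ?thesis
    unfolding eq by linarith
qed

text \<open>Continuity is demanded of the decoder alone. Test functions are composed with
  \<open>\<phi>\<close> to become continuous on the line, while \<open>s\<close> only ever occurs
  inside the argument of a functional defined on all bounded functions.\<close>

lemma compact_real_coding:
  fixes K :: "'a::euclidean_space set"
  assumes K: "compact K"
  obtains s :: "'a \<Rightarrow> real" and \<phi> :: "real \<Rightarrow> 'a"
  where "bounded (range s)" "continuous_on UNIV \<phi>" "\<And>k. k \<in> K \<Longrightarrow> \<phi> (s k) = k"
proof -
  obtain BB :: "'a set set" where BB: "countable BB" "topological_basis BB"
    using ex_countable_basis by blast
  have base: "\<exists>b\<in>BB. x \<in> b \<and> b \<subseteq> U" if "open U" "x \<in> U" for x U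
    by (rule topological_basisE[OF BB(2) that]) blast
  define B where "B = from_nat_into BB"
  have "BB \<noteq> {}"
    using base[OF open_UNIV] by blast
  then have range_B: "range B = BB"
    unfolding B_def using BB(1) by (rule range_from_nat_into)
  have open_B: "open (B n)" for n
    using topological_basis_open[OF BB(2)] range_B by blast
  \<comment> \<open>The ternary digits of \<open>s x\<close> record membership in the basic open sets. By compactness finitely many
    digits determine a point up to \<open>\<epsilon>\<close>, so the inverse of \<open>s\<close> is uniformly continuous.\<close>
  define s where "s x = suminf (\<lambda>k. indicat_real (B k) x * (1 / 3) ^ k)" for x
  have geo: "summable (\<lambda>k. (1 / 3 :: real) ^ k)" "suminf (\<lambda>k. (1 / 3 :: real) ^ k) = 3 / 2"
    using suminf_geometric[of "1/3 :: real"] by (auto intro: summable_geometric)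
  have sm: "summable (\<lambda>k. indicat_real (B k) x * (1 / 3) ^ k)" for x
    by (rule summable_comparison_test'[OF geo(1)]) (auto simp: indicator_def)
  have "bounded (range s)"
  proof (rule boundedI)
    fix y assume "y \<in> range s"
    then obtain x where y: "y = s x" by blast
    have "0 \<le> s x"
      unfolding s_def by (intro suminf_nonneg sm) auto
    moreover have "s x \<le> 3 / 2"
      unfolding s_def geo(2)[symmetric]
      by (intro suminf_le sm geo) (auto simp: indicator_def)
    ultimately show "norm y \<le> 3 / 2" by (simp add: y)
  qed
  have digits: "x \<in> B n \<longleftrightarrow> y \<in> B n" if d: "\<bar>s x - s y\<bar> < (1 / 3) ^ M / 2" and "n \<le> M" for x y n M
  proof (rule ccontr)
    assume "\<not> (x \<in> B n \<longleftrightarrow> y \<in> B n)"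
    \<comment> \<open>The first digit where \<open>x\<close> and \<open>y\<close> differ; it comes
      no later than position \<open>M\<close> and already separates the codes by too much.\<close>
    define m where "m = (LEAST k. \<not> (x \<in> B k \<longleftrightarrow> y \<in> B k))"
    have m: "\<not> (x \<in> B m \<longleftrightarrow> y \<in> B m)" "m \<le> n"
      unfolding m_def using \<open>\<not> (x \<in> B n \<longleftrightarrow> y \<in> B n)\<close> by (fact LeastI, fact Least_le)
    have below: "x \<in> B k \<longleftrightarrow> y \<in> B k" if "k < m" for k
      using not_less_Least[OF that[unfolded m_def]] by simp
    have "(1 / 3) ^ m / 2 \<le> \<bar>suminf (\<lambda>k. (indicat_real (B k) x - indicat_real (B k) y) * (1 / 3) ^ k)\<bar>"
      by (rule abs_suminf_digits_ge) (use m below in \<open>auto simp: indicator_def\<close>)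
    also have "suminf (\<lambda>k. (indicat_real (B k) x - indicat_real (B k) y) * (1 / 3) ^ k) = s x - s y"
      unfolding s_def left_diff_distrib by (rule suminf_diff[symmetric]; rule sm)
    finally have "(1 / 3) ^ m / 2 \<le> \<bar>s x - s y\<bar>" .
    moreover have "(1 / 3 :: real) ^ M \<le> (1 / 3) ^ m"
      using m(2) \<open>n \<le> M\<close> by (intro power_decreasing) auto
    ultimately show False using d by linarith
  qed
  have close: "\<exists>\<delta>>0. \<forall>x\<in>K. \<forall>y\<in>K. \<bar>s x - s y\<bar> < \<delta> \<longrightarrow> dist x y < \<epsilon>" if "\<epsilon> > 0" for \<epsilon>
  proof -
    have "\<exists>n. x \<in> B n \<and> B n \<subseteq> ball x (\<epsilon> / 2)" for x
      using base[of "ball x (\<epsilon> / 2)" x] that unfolding range_B[symmetric] by auto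
    then obtain N where N: "\<And>x. x \<in> B (N x)" "\<And>x. B (N x) \<subseteq> ball x (\<epsilon> / 2)"
      by metis
    have "K \<subseteq> (\<Union>x\<in>K. B (N x))"
      using N(1) by blast
    then obtain T where T: "T \<subseteq> K" "finite T" "K \<subseteq> (\<Union>x\<in>T. B (N x))"
      by (rule compactE_image[OF K open_B])
    obtain M where M: "\<And>x. x \<in> T \<Longrightarrow> N x \<le> M"
      using finite_nat_set_iff_bounded_le[of "N ` T"] T(2) by blast
    show ?thesis
    proof (intro exI[of _ "(1 / 3) ^ M / 2"] conjI ballI impI)
      fix x y assume xy: "x \<in> K" "y \<in> K" "\<bar>s x - s y\<bar> < (1 / 3) ^ M / 2"
      obtain z where z: "z \<in> T" "x \<in> B (N z)"
        using T(3) xy(1) by blast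
      then have "y \<in> B (N z)"
        using digits[OF xy(3) M] by blast
      then have "dist z x < \<epsilon> / 2" "dist z y < \<epsilon> / 2"
        using N(2)[of z] z(2) by auto
      then show "dist x y < \<epsilon>"
        by (rule dist_triangle_half_r)
    qed simp
  qed
  have inj: "x = y" if "x \<in> K" "y \<in> K" "s x = s y" for x y
  proof (rule ccontr)
    assume "x \<noteq> y"
    then show False
      using close[of "dist x y"] that by force
  qed
  have inv: "inv_into K s (s x) = x" if "x \<in> K" for x
    using that inj by (intro inv_into_f_f inj_onI)
  have "uniformly_continuous_on (s ` K) (inv_into K s)"
    unfolding uniformly_continuous_on_def
  proof (intro allI impI)
    fix \<epsilon> :: real assume "\<epsilon> > 0"
    from close[OF this] obtain \<delta> where "\<delta> > 0" "\<And>x y. x \<in> K \<Longrightarrow> y \<in> K \<Longrightarrow> \<bar>s x - s y\<bar> < \<delta> \<Longrightarrow> dist x y < \<epsilon>"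
      by blast
    then show "\<exists>d>0. \<forall>x\<in>s ` K. \<forall>x'\<in>s ` K. dist x' x < d \<longrightarrow> dist (inv_into K s x') (inv_into K s x) < \<epsilon>"
      by (intro exI[of _ \<delta>]) (auto simp: inv dist_real_def)
  qed
  \<comment> \<open>The decoder is extended twice: by uniform continuity to the closure of the set
    of codes, and from this closed set to the whole line by Tietze's theorem.\<close>
  then have "\<exists>g. uniformly_continuous_on (closure (s ` K)) g \<and> (\<forall>x\<in>s ` K. inv_into K s x = g x)"
    by (rule uniformly_continuous_on_extension_on_closure) blast
  then obtain g where g: "uniformly_continuous_on (closure (s ` K)) g"
    "\<And>x. x \<in> s ` K \<Longrightarrow> inv_into K s x = g x"
    by blast
  obtain \<phi> where \<phi>: "continuous_on UNIV \<phi>" "\<And>x. x \<in> closure (s ` K) \<Longrightarrow> \<phi> x = g x"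
    using Tietze_unbounded[of "closure (s ` K)" g UNIV] uniformly_continuous_imp_continuous[OF g(1)]
    by auto
  have "\<phi> (s k) = k" if "k \<in> K" for k
    using \<phi>(2)[of "s k"] g(2)[of "s k"] inv[OF that] that closure_subset[of "s ` K"] by auto
  with \<open>bounded (range s)\<close> \<phi>(1) show ?thesis by (rule that)
qed

section \<open>From positive functionals to measures\<close>

text \<open>Arguments are arbitrary bounded functions, continuous or not. Hence indicators of level
  sets and rounded functions can be inserted into \<open>\<Lambda>\<close>.\<close>

locale bounded_functional =
  fixes \<Lambda> :: "('a \<Rightarrow> real) \<Rightarrow> real"
  assumes comb: "bounded (range f) \<Longrightarrow> bounded (range g) \<Longrightarrow>
      \<Lambda> (\<lambda>x. a * f x + b * g x) = a * \<Lambda> f + b * \<Lambda> g"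
    and nonneg: "bounded (range f) \<Longrightarrow> (\<And>x. 0 \<le> f x) \<Longrightarrow> 0 \<le> \<Lambda> f"
begin

lemma bounded_comb:
  fixes f g :: "'a \<Rightarrow> real"
  shows "bounded (range f) \<Longrightarrow> bounded (range g) \<Longrightarrow> bounded (range (\<lambda>x. a * f x + b * g x))"
  using bounded_plus_comp[of "\<lambda>x. a * f x" UNIV "\<lambda>x. b * g x"]
    bounded_scaleR_comp[of f UNIV a] bounded_scaleR_comp[of g UNIV b] by simp

lemma mono:
  assumes "bounded (range f)" "bounded (range g)" "\<And>x. f x \<le> g x"
  shows "\<Lambda> f \<le> \<Lambda> g"
proof -
  have "0 \<le> \<Lambda> (\<lambda>x. 1 * g x + (- 1) * f x)"
    using assms by (intro nonneg bounded_comb) auto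
  also have "\<dots> = \<Lambda> g - \<Lambda> f"
    by (subst comb) (use assms in auto)
  finally show ?thesis by simp
qed

lemma cmult: "bounded (range f) \<Longrightarrow> \<Lambda> (\<lambda>x. c * f x) = c * \<Lambda> f"
  using comb[of f f c 0] by simp

lemma abs_diff_le:
  assumes f: "bounded (range f)" and g: "bounded (range g)" and le: "\<And>x. \<bar>f x - g x\<bar> \<le> \<epsilon>"
  shows "\<bar>\<Lambda> f - \<Lambda> g\<bar> \<le> \<epsilon> * \<Lambda> (\<lambda>x. 1)"
proof -
  have const: "bounded (range (\<lambda>x::'a. c))" for c :: real
    by simp
  have "\<Lambda> f \<le> \<Lambda> (\<lambda>x. 1 * g x + \<epsilon> * 1)" "\<Lambda> g \<le> \<Lambda> (\<lambda>x. 1 * f x + \<epsilon> * 1)"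
    using le by (intro mono f g bounded_comb[OF g const] bounded_comb[OF f const];
        simp add: abs_le_iff algebra_simps)+
  then show ?thesis
    unfolding comb[OF f const] comb[OF g const] by (simp add: abs_le_iff)
qed

lemma sum:
  assumes "finite A" "\<And>i. i \<in> A \<Longrightarrow> bounded (range (f i))"
  shows "bounded (range (\<lambda>x. \<Sum>i\<in>A. c i * f i x)) \<and>
    \<Lambda> (\<lambda>x. \<Sum>i\<in>A. c i * f i x) = (\<Sum>i\<in>A. c i * \<Lambda> (f i))"
  using assms
proof (induction A rule: finite_induct)
  case empty
  have "\<Lambda> (\<lambda>x. 0) = 0"
    using cmult[of "\<lambda>x. 0" 0] by simp
  then show ?case by simp
next
  case (insert i A)
  then show ?case
    using comb[of "f i" "\<lambda>x. \<Sum>i\<in>A. c i * f i x" "c i" 1]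
      bounded_comb[of "f i" "\<lambda>x. \<Sum>i\<in>A. c i * f i x" "c i" 1] by simp
qed

text \<open>The weight of \<open>z\<close> is the value of \<open>\<Lambda>\<close> at the indicator
  of \<open>t x = z\<close>. Because \<open>t\<close> has finitely many values, each
  \<open>g (t x)\<close> is a finite linear combination of these indicators, so finite additivity is
  enough.\<close>

lemma finite_range_pmf:
  assumes one: "\<Lambda> (\<lambda>x. 1) = 1" and fin: "finite (range t)"
  obtains P where "set_pmf P \<subseteq> range t"
    "\<And>g :: 'b \<Rightarrow> real. measure_pmf.expectation P g = \<Lambda> (\<lambda>x. g (t x))"
proof -
  define p where "p z = \<Lambda> (\<lambda>x. of_bool (t x = z))" for z
  have b: "bounded (range (\<lambda>x. of_bool (t x = z) :: real))" for z
    by (rule boundedI[of _ 1]) auto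
  have p_nonneg: "0 \<le> p z" for z
    unfolding p_def by (intro nonneg b) simp
  have p_0: "p z = 0" if "z \<notin> range t" for z
  proof -
    have "(\<lambda>x. of_bool (t x = z)) = (\<lambda>x. 0 * (1::real))"
      using that by (auto simp: fun_eq_iff)
    then show ?thesis
      unfolding p_def using cmult[of "\<lambda>x. 1" 0] by simp
  qed
  have expand: "(\<Sum>z\<in>range t. g z * p z) = \<Lambda> (\<lambda>x. g (t x))" for g
  proof -
    have "(\<lambda>x. g (t x)) = (\<lambda>x. \<Sum>z\<in>range t. g z * of_bool (t x = z))"
      using fin by (simp add: fun_eq_iff of_bool_def if_distrib[of "(*) _"] cong: if_cong)
    then show ?thesis
      using sum[OF fin, of "\<lambda>z x. of_bool (t x = z)" g] b unfolding p_def by simp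
  qed
  have "(\<integral>\<^sup>+z. ennreal (p z) \<partial>count_space UNIV) = (\<Sum>z\<in>range t. ennreal (p z))"
    using fin p_0 by (intro nn_integral_count_space') auto
  also have "\<dots> = 1"
    using expand[of "\<lambda>_. 1"] one p_nonneg by (simp add: sum_ennreal)
  finally have prob: "(\<integral>\<^sup>+z. ennreal (p z) \<partial>count_space UNIV) = 1" .
  show ?thesis
  proof (rule that)
    show set: "set_pmf (embed_pmf p) \<subseteq> range t"
      using p_0 by (auto simp: set_embed_pmf[OF p_nonneg prob])
    show "measure_pmf.expectation (embed_pmf p) g = \<Lambda> (\<lambda>x. g (t x))" for g
      using integral_measure_pmf_real[OF fin, of "embed_pmf p" g] set
      by (simp add: pmf_embed_pmf[OF p_nonneg prob] expand subset_iff)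
  qed
qed

text \<open>Rounding \<open>s\<close> down to multiples of \<open>1 / (n + 1)\<close> gives
  functions \<open>t n\<close> of finite range, each with a law on the line. All these laws live in
  one bounded interval, so a subsequence converges weakly. For continuous \<open>g\<close> the
  functions \<open>g (t n x)\<close> tend to \<open>g (s x)\<close> uniformly, which identifies the
  integrals against the limit.\<close>

lemma ex_real_distribution:
  assumes one: "\<Lambda> (\<lambda>x. 1) = 1" and s: "bounded (range s)"
  obtains \<nu> where "real_distribution \<nu>"
    "\<And>g B. continuous_on UNIV g \<Longrightarrow> (\<And>x. \<bar>g x\<bar> \<le> B) \<Longrightarrow> (\<integral>x. g x \<partial>\<nu>) = \<Lambda> (\<lambda>x. g (s x))"
proof -
  obtain C where C: "\<And>x. \<bar>s x\<bar> \<le> C"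
    using s unfolding bounded_iff by auto
  define t where "t n x = of_int \<lfloor>real (Suc n) * s x\<rfloor> / real (Suc n)" for n x
  have t: "\<bar>t n x - s x\<bar> \<le> 1 / real (Suc n)" for n x
  proof -
    have "\<bar>of_int \<lfloor>real (Suc n) * s x\<rfloor> - real (Suc n) * s x\<bar> \<le> 1"
      by linarith
    then have "\<bar>of_int \<lfloor>real (Suc n) * s x\<rfloor> - real (Suc n) * s x\<bar> / real (Suc n) \<le> 1 / real (Suc n)"
      by (intro divide_right_mono) auto
    also have "\<bar>of_int \<lfloor>real (Suc n) * s x\<rfloor> - real (Suc n) * s x\<bar> / real (Suc n)
        = \<bar>(of_int \<lfloor>real (Suc n) * s x\<rfloor> - real (Suc n) * s x) / real (Suc n)\<bar>"
      by simp
    also have "(of_int \<lfloor>real (Suc n) * s x\<rfloor> - real (Suc n) * s x) / real (Suc n) = t n x - s x"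
      by (simp add: t_def diff_divide_distrib)
    finally show ?thesis .
  qed
  have t_bd: "\<bar>t n x\<bar> \<le> C + 1" for n x
  proof -
    have "1 / real (Suc n) \<le> 1" by simp
    with t[of n x] C[of x] show ?thesis by linarith
  qed
  have fin: "finite (range (t n))" for n
  proof -
    have "\<bar>real (Suc n) * s x\<bar> \<le> real (Suc n) * C" for x
      using mult_left_mono[OF C[of x], of "real (Suc n)"] by (simp add: abs_mult)
    then have "\<lfloor>real (Suc n) * s x\<rfloor> \<in> {\<lfloor>- (real (Suc n) * C)\<rfloor>..\<lfloor>real (Suc n) * C\<rfloor>}" for x
      by (auto simp: abs_le_iff intro!: floor_mono) (smt (verit))+
    then have "range (t n) \<subseteq> (\<lambda>k. of_int k / real (Suc n)) ` {\<lfloor>- (real (Suc n) * C)\<rfloor>..\<lfloor>real (Suc n) * C\<rfloor>}"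
      unfolding t_def by blast
    then show ?thesis
      by (rule finite_subset) simp
  qed
  have "\<exists>P. set_pmf P \<subseteq> range (t n) \<and> (\<forall>g. measure_pmf.expectation P g = \<Lambda> (\<lambda>x. g (t n x)))" for n
    by (rule finite_range_pmf[OF one fin[of n]]) blast
  then obtain P where P: "\<And>n. set_pmf (P n) \<subseteq> range (t n)"
    "\<And>n g. measure_pmf.expectation (P n) g = \<Lambda> (\<lambda>x. g (t n x))"
    by metis
  \<comment> \<open>For a \<open>pmf\<close> every set is measurable; the push-forward along the
    identity restricts it to the Borel sets.\<close>
  define M where "M n = distr (measure_pmf (P n)) borel (\<lambda>x. x)" for n
  have M: "real_distribution (M n)" for n
    unfolding M_def by (intro prob_space.real_distribution_distr measure_pmf.prob_space_axioms) simp
  have M_int: "(\<integral>x. g x \<partial>M n) = \<Lambda> (\<lambda>x. g (t n x))" if "g \<in> borel_measurable borel" for g n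
    unfolding M_def by (subst integral_distr) (use that P(2) in auto)
  have "tight M"
    unfolding tight_def
  proof (intro conjI allI impI)
    fix \<epsilon> :: real assume "\<epsilon> > 0"
    have "measure (M n) {- C - 2<..C + 2} = 1" for n
    proof -
      have "set_pmf (P n) \<subseteq> {- C - 2<..C + 2}"
      proof
        fix z assume "z \<in> set_pmf (P n)"
        then obtain x where "z = t n x" using P(1)[of n] by blast
        then show "z \<in> {- C - 2<..C + 2}" using t_bd[of n x] by (simp add: abs_le_iff)
      qed
      then have "measure (measure_pmf (P n)) {- C - 2<..C + 2} = 1"
        by (subst measure_pmf.prob_eq_1) (auto simp: AE_measure_pmf_iff)
      then show ?thesis
        unfolding M_def by (subst measure_distr) auto
    qed
    moreover have "- C - 2 < C + 2"
      using C[of undefined] abs_ge_zero[of "s undefined"] by linarith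
    ultimately show "\<exists>a b. a < b \<and> (\<forall>n. 1 - \<epsilon> < measure (M n) {a<..b})"
      using \<open>\<epsilon> > 0\<close> by (intro exI[of _ "- C - 2"] exI[of _ "C + 2"]) simp
  qed (rule M)
  from tight_imp_convergent_subsubsequence[OF this strict_mono_id]
  obtain r \<nu> where r: "strict_mono r" and \<nu>: "real_distribution \<nu>" "weak_conv_m (M \<circ> r) \<nu>"
    by auto
  show ?thesis
  proof (rule that[OF \<nu>(1)])
    fix g :: "real \<Rightarrow> real" and B assume g: "continuous_on UNIV g" and B: "\<And>x. \<bar>g x\<bar> \<le> B"
    have gm: "g \<in> borel_measurable borel"
      using g by (rule borel_measurable_continuous_onI)
    have bg: "bounded (range (\<lambda>x. g (h x)))" for h :: "'a \<Rightarrow> real"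
      using B by (intro boundedI[of _ B]) auto
    \<comment> \<open>The same sequence of integrals is given two limits: one by weak convergence,
      one by uniform approximation of \<open>s\<close>.\<close>
    have "(\<lambda>n. \<integral>x. g x \<partial>(M \<circ> r) n) \<longlonglongrightarrow> (\<integral>x. g x \<partial>\<nu>)"
    proof (rule weak_conv_imp_integral_bdd_continuous_conv)
      show "isCont g x" for x using g by (simp add: continuous_on_eq_continuous_at)
    qed (use B M \<nu> in \<open>auto simp: comp_def\<close>)
    moreover have "(\<lambda>n. \<integral>x. g x \<partial>(M \<circ> r) n) \<longlonglongrightarrow> \<Lambda> (\<lambda>x. g (s x))"
    proof -
      have "(\<lambda>n. \<Lambda> (\<lambda>x. g (t n x))) \<longlonglongrightarrow> \<Lambda> (\<lambda>x. g (s x))"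
      proof (rule LIMSEQ_I)
        fix \<epsilon> :: real assume "\<epsilon> > 0"
        have "uniformly_continuous_on {- C - 1..C + 1} g"
          using g by (intro compact_uniformly_continuous continuous_on_subset[OF g]) auto
        then obtain \<delta> where \<delta>: "\<delta> > 0" "\<And>x y. x \<in> {- C - 1..C + 1} \<Longrightarrow> y \<in> {- C - 1..C + 1} \<Longrightarrow>
            \<bar>x - y\<bar> < \<delta> \<Longrightarrow> \<bar>g x - g y\<bar> < \<epsilon> / 2"
          unfolding uniformly_continuous_on_def dist_real_def using \<open>\<epsilon> > 0\<close>
          by (metis half_gt_zero)
        obtain N where N: "1 / real (Suc N) < \<delta>"
          using \<delta>(1) nat_approx_posE by blast
        show "\<exists>no. \<forall>n\<ge>no. norm (\<Lambda> (\<lambda>x. g (t n x)) - \<Lambda> (\<lambda>x. g (s x))) < \<epsilon>"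
        proof (intro exI[of _ N] allI impI)
          fix n assume "n \<ge> N"
          then have "1 / real (Suc n) \<le> 1 / real (Suc N)" by (simp add: frac_le)
          then have "\<bar>t n x - s x\<bar> < \<delta>" for x
            using t[of n x] N by linarith
          moreover have "t n x \<in> {- C - 1..C + 1}" "s x \<in> {- C - 1..C + 1}" for x
            using t_bd[of n x] C[of x] by (auto simp: abs_le_iff)
          ultimately have "\<bar>g (t n x) - g (s x)\<bar> \<le> \<epsilon> / 2" for x
            using \<delta>(2) by (simp add: less_imp_le)
          then have "\<bar>\<Lambda> (\<lambda>x. g (t n x)) - \<Lambda> (\<lambda>x. g (s x))\<bar> \<le> \<epsilon> / 2 * \<Lambda> (\<lambda>x. 1)"
            by (intro abs_diff_le bg)
          then show "norm (\<Lambda> (\<lambda>x. g (t n x)) - \<Lambda> (\<lambda>x. g (s x))) < \<epsilon>"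
            using \<open>\<epsilon> > 0\<close> by (simp add: one)
        qed
      qed
      from LIMSEQ_subseq_LIMSEQ[OF this r] show ?thesis
        by (simp add: o_def M_int[OF gm])
    qed
    ultimately show "(\<integral>x. g x \<partial>\<nu>) = \<Lambda> (\<lambda>x. g (s x))"
      by (rule LIMSEQ_unique)
  qed
qed

end

section \<open>From the line back to Euclidean space\<close>

lemma bounded_range_vanishing_at_infinity:
  fixes f :: "'a::euclidean_space \<Rightarrow> real"
  assumes "continuous_on UNIV f" "\<And>x. R \<le> norm x \<Longrightarrow> f x = 0"
  shows "bounded (range f)"
proof -
  have "compact (f ` cball 0 R)"
    by (intro compact_continuous_image continuous_on_subset[OF assms(1)] compact_cball) auto
  then have "bounded (insert 0 (f ` cball 0 R))"
    by (simp add: compact_imp_bounded)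
  moreover have "range f \<subseteq> insert 0 (f ` cball 0 R)"
  proof clarify
    fix x assume "f x \<notin> f ` cball 0 R"
    then have "x \<notin> cball 0 R" by blast
    then show "f x = 0" by (intro assms(2)) simp
  qed
  ultimately show ?thesis
    by (rule bounded_subset)
qed

text \<open>
  \<open>k /\<^sub>R (1 - norm k)\<close> inverts the compactification \<open>x /\<^sub>R (1 + norm x)\<close>; truncating the denominator
  makes the pulled-back function continuous on the whole space.
\<close>

lemma radial_rescaling:
  fixes f :: "'a::real_normed_vector \<Rightarrow> real"
  assumes R: "0 \<le> R" and f: "\<And>x. R \<le> norm x \<Longrightarrow> f x = 0"
  shows "f (k /\<^sub>R max (1 - norm k) (1 / (1 + R))) = (if norm k < 1 then f (k /\<^sub>R (1 - norm k)) else 0)"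
proof (cases "norm k \<le> R / (1 + R)")
  case True
  have "R / (1 + R) + 1 / (1 + R) = 1" "R / (1 + R) < 1"
    using R by (simp_all add: field_simps)
  then have "1 / (1 + R) \<le> 1 - norm k" "norm k < 1"
    using True by linarith+
  then show ?thesis by (simp add: max_def)
next
  case False
  have "R / (1 + R) + 1 / (1 + R) = 1"
    using R by (simp add: field_simps)
  then have d: "1 - norm k < 1 / (1 + R)"
    using False by linarith
  have R_le: "R \<le> norm k * (1 + R)"
    using False R by (simp add: field_simps)
  have "R \<le> norm (k /\<^sub>R max (1 - norm k) (1 / (1 + R)))"
    using d R R_le by (simp add: max_def divide_inverse mult.commute)
  moreover have "R \<le> norm (k /\<^sub>R (1 - norm k))" if "norm k < 1"
  proof -
    have "R * (1 - norm k) \<le> norm k"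
      using R_le by (simp add: algebra_simps)
    then show ?thesis
      using that by (simp add: field_simps)
  qed
  ultimately show ?thesis using f by simp
qed

text \<open>Compress the space into the open unit ball by \<open>x /\<^sub>R (1 + norm x)\<close>,
  code the closed ball on the line, take the distribution of the codes, and decode. Mass that the
  weak limit has moved to the unit sphere has escaped to infinity and is discarded; functions of
  compact support do not see it.\<close>

lemma compactly_supported_representation:
  fixes \<Lambda> :: "('a::euclidean_space \<Rightarrow> real) \<Rightarrow> real"
  assumes "bounded_functional \<Lambda>"
  obtains \<mu> where "sets \<mu> = sets borel" "finite_measure \<mu>"
    "\<And>f R. continuous_on UNIV f \<Longrightarrow> (\<And>x. R \<le> norm x \<Longrightarrow> f x = 0) \<Longrightarrow> (\<integral>x. f x \<partial>\<mu>) = \<Lambda> f"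
proof -
  interpret bounded_functional \<Lambda> by fact
  define c where "c = \<Lambda> (\<lambda>_. 1)"
  have "c \<ge> 0"
    unfolding c_def by (intro nonneg) auto
  show ?thesis
  proof (cases "c = 0")
    \<comment> \<open>With \<open>c = 0\<close> there is nothing to normalise, but then
      \<open>\<Lambda>\<close> vanishes on all bounded functions.\<close>
    case True
    have "\<Lambda> f = 0" if "bounded (range f)" for f
    proof -
      obtain C where "\<And>x. \<bar>f x\<bar> \<le> C"
        using \<open>bounded (range f)\<close> unfolding bounded_iff by auto
      then have "\<bar>\<Lambda> f - \<Lambda> (\<lambda>_. 0)\<bar> \<le> C * c"
        unfolding c_def using that by (intro abs_diff_le) auto
      moreover have "\<Lambda> (\<lambda>_. 0) = 0"
        using cmult[of "\<lambda>_. 1" 0] by simp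
      ultimately show ?thesis using True by simp
    qed
    then show ?thesis
      by (intro that[of "null_measure borel"])
        (auto intro!: finite_measureI bounded_range_vanishing_at_infinity simp: integral_null_measure)
  next
    case False
    with \<open>c \<ge> 0\<close> have "c > 0" by simp
    obtain s :: "'a \<Rightarrow> real" and \<phi> :: "real \<Rightarrow> 'a" where
      s: "bounded (range s)" and \<phi>: "continuous_on UNIV \<phi>" and \<phi>s: "\<And>k. k \<in> cball 0 1 \<Longrightarrow> \<phi> (s k) = k"
      using compact_real_coding[OF compact_cball] by blast
    define h where "h x = x /\<^sub>R (1 + norm x)" for x :: 'a
    have h: "norm (h x) = norm x / (1 + norm x)" "1 - norm (h x) = 1 / (1 + norm x)" "norm (h x) < 1" for x
    proof -
      have "0 < 1 + norm x" by (smt (verit) norm_ge_zero)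
      then show "norm (h x) = norm x / (1 + norm x)" "1 - norm (h x) = 1 / (1 + norm x)" "norm (h x) < 1"
        unfolding h_def by (simp_all add: field_simps)
    qed
    have h_inv: "h x /\<^sub>R (1 - norm (h x)) = x" for x
    proof -
      have "1 + norm x \<noteq> 0" by (smt (verit) norm_ge_zero)
      then show ?thesis unfolding h(2) by (simp add: h_def)
    qed
    \<comment> \<open>Decoding followed by the inverse of the compression. It is meaningful only
      where \<open>norm (\<phi> t) < 1\<close>; elsewhere the weight \<open>w\<close> below is
      zero.\<close>
    define \<psi> where "\<psi> t = \<phi> t /\<^sub>R (1 - norm (\<phi> t))" for t
    have [measurable]: "\<phi> \<in> borel_measurable borel"
      using \<phi> by (rule borel_measurable_continuous_onI)
    have [measurable]: "\<psi> \<in> borel_measurable borel"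
      unfolding \<psi>_def by measurable
    interpret \<Lambda>1: bounded_functional "\<lambda>f. \<Lambda> f / c"
      using \<open>c > 0\<close> by unfold_locales (simp_all add: comb add_divide_distrib nonneg)
    have sh: "bounded (range (\<lambda>x. s (h x)))"
      by (rule bounded_subset[OF s]) blast
    have "\<exists>\<nu>. real_distribution \<nu> \<and> (\<forall>g B. continuous_on UNIV g \<longrightarrow> (\<forall>x. \<bar>g x\<bar> \<le> B) \<longrightarrow>
        (\<integral>x. g x \<partial>\<nu>) = \<Lambda> (\<lambda>x. g (s (h x))) / c)"
      by (rule \<Lambda>1.ex_real_distribution[OF _ sh]) (use \<open>c > 0\<close> in \<open>simp add: c_def[symmetric]\<close>, blast)
    then obtain \<nu> where \<nu>: "real_distribution \<nu>"
      and int_\<nu>: "\<And>g B. continuous_on UNIV g \<Longrightarrow> (\<And>x. \<bar>g x\<bar> \<le> B) \<Longrightarrow>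
        (\<integral>x. g x \<partial>\<nu>) = \<Lambda> (\<lambda>x. g (s (h x))) / c"
      by blast
    interpret real_distribution \<nu> by fact
    define w where "w t = c * indicator {t. norm (\<phi> t) < 1} t" for t
    have [measurable]: "w \<in> borel_measurable \<nu>"
      unfolding w_def by measurable
    have w: "0 \<le> w t" "w t \<le> c" for t
      using \<open>c > 0\<close> by (auto simp: w_def indicator_def)
    define \<mu> where "\<mu> = distr (density \<nu> (\<lambda>t. ennreal (w t))) borel \<psi>"
    have "finite_measure \<mu>"
    proof (rule finite_measureI)
      have "emeasure \<mu> (space \<mu>) = (\<integral>\<^sup>+t. ennreal (w t) \<partial>\<nu>)"
        unfolding \<mu>_def by (subst emeasure_distr) (auto simp: emeasure_density)
      also have "\<dots> \<le> (\<integral>\<^sup>+t. ennreal c \<partial>\<nu>)"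
        using w by (intro nn_integral_mono) (simp add: ennreal_leI)
      also have "\<dots> = ennreal c"
        using emeasure_space_1 by simp
      also have "\<dots> < \<infinity>" by simp
      finally show "emeasure \<mu> (space \<mu>) \<noteq> \<infinity>" by simp
    qed
    moreover have "(\<integral>x. f x \<partial>\<mu>) = \<Lambda> f"
      if f: "continuous_on UNIV f" "\<And>x. R \<le> norm x \<Longrightarrow> f x = 0" for f R
    proof -
      \<comment> \<open>A negative \<open>R\<close> is admissible here, whereas the truncation
        \<open>1 / (1 + R')\<close> must be positive.\<close>
      define R' where "R' = max R 0"
      have R': "0 \<le> R'" "\<And>x. R' \<le> norm x \<Longrightarrow> f x = 0"
        using f(2) by (auto simp: R'_def)
      \<comment> \<open>The truncated denominator makes \<open>g\<close> continuous and bounded on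
        the line, so that \<open>\<nu>\<close> can be tested with it, and \<open>g\<close> agrees
        with \<open>f \<circ> \<psi>\<close> inside the ball and with 0 outside.\<close>
      define g where "g t = f (\<phi> t /\<^sub>R max (1 - norm (\<phi> t)) (1 / (1 + R')))" for t
      have g: "g t = (if norm (\<phi> t) < 1 then f (\<psi> t) else 0)" for t
        unfolding g_def \<psi>_def by (rule radial_rescaling[OF R'])
      obtain B where B: "\<And>x. \<bar>f x\<bar> \<le> B"
        using bounded_range_vanishing_at_infinity[OF f] unfolding bounded_iff by auto
      have fm: "f \<in> borel_measurable borel"
        using f(1) by (rule borel_measurable_continuous_onI)
      have "(\<integral>x. f x \<partial>\<mu>) = (\<integral>t. w t *\<^sub>R f (\<psi> t) \<partial>\<nu>)"
        unfolding \<mu>_def using fm w(1) by (simp add: integral_distr integral_density)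
      also have "\<dots> = (\<integral>t. c * g t \<partial>\<nu>)"
        by (intro Bochner_Integration.integral_cong refl) (simp add: g w_def)
      also have "\<dots> = c * (\<integral>t. g t \<partial>\<nu>)"
        by simp
      also have "(\<integral>t. g t \<partial>\<nu>) = \<Lambda> (\<lambda>x. g (s (h x))) / c"
      proof (rule int_\<nu>)
        have "max (1 - norm (\<phi> t)) (1 / (1 + R')) \<noteq> 0" for t
          using R'(1) by (auto simp: max_def)
        then show "continuous_on UNIV g"
          unfolding g_def
          by (intro continuous_intros \<phi> continuous_on_compose2[OF f(1)]) auto
        show "\<bar>g t\<bar> \<le> B" for t unfolding g_def by (rule B)
      qed
      also have "(\<lambda>x. g (s (h x))) = f"
      proof
        fix x
        have "\<phi> (s (h x)) = h x"
          using h(3)[of x] by (intro \<phi>s) simp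
        then show "g (s (h x)) = f x"
          unfolding g using h(3)[of x] h_inv[of x] by (simp add: \<psi>_def)
      qed
      finally show ?thesis using \<open>c > 0\<close> by simp
    qed
    ultimately show ?thesis
      by (intro that[of \<mu>]) (auto simp: \<mu>_def)
  qed
qed

section \<open>Haviland's theorem for adapted spaces\<close>

text \<open>The measure represents \<open>\<Lambda>\<close> on compactly supported functions only.
  By \<open>growth\<close>, the part of \<open>e p\<close> outside the ball of radius
  \<open>n\<close> is at most \<open>e q / (1 + n\<^sup>2)\<close>, so its value under
  \<open>\<Lambda>\<close> tends to 0 and no moment is lost at infinity.\<close>

theorem adapted_Haviland:
  fixes e :: "'p::real_vector \<Rightarrow> 'a::euclidean_space \<Rightarrow> real" and L :: "'p \<Rightarrow> real"
  assumes e: "\<And>x. linear (\<lambda>p. e p x)" and cont: "\<And>p. continuous_on UNIV (e p)"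
    and one: "\<And>x. e one x = 1"
    and growth: "\<And>p. \<exists>q. \<forall>x. (1 + (norm x)\<^sup>2) * \<bar>e p x\<bar> \<le> e q x"
    and L: "linear L" and pos: "\<And>p. (\<And>x. 0 \<le> e p x) \<Longrightarrow> 0 \<le> L p"
  obtains \<mu> where "sets \<mu> = sets borel" "\<And>p. integrable \<mu> (e p)" "\<And>p. (\<integral>x. e p x \<partial>\<mu>) = L p"
proof -
  obtain \<Lambda> where \<Lambda>_e: "\<And>p. \<Lambda> (e p) = L p"
    and \<Lambda>_comb: "\<And>f g p q a b. (\<And>x. \<bar>f x\<bar> \<le> e p x) \<Longrightarrow> (\<And>x. \<bar>g x\<bar> \<le> e q x) \<Longrightarrow>
       \<Lambda> (\<lambda>x. a * f x + b * g x) = a * \<Lambda> f + b * \<Lambda> g"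
    and \<Lambda>_nonneg: "\<And>f p. (\<And>x. \<bar>f x\<bar> \<le> e p x) \<Longrightarrow> (\<And>x. 0 \<le> f x) \<Longrightarrow> 0 \<le> \<Lambda> f"
    using M_Riesz_extension[of e L, OF e L pos] by blast
  have dom_bounded: "\<exists>p. \<forall>x. \<bar>f x\<bar> \<le> e p x" if "bounded (range f)" for f
  proof -
    obtain C where "\<And>x. \<bar>f x\<bar> \<le> C"
      using \<open>bounded (range f)\<close> unfolding bounded_iff by auto
    then show ?thesis
      using linear_scale[OF e, of C one] one by (intro exI[of _ "C *\<^sub>R one"]) simp
  qed
  interpret bounded_functional \<Lambda>
  proof
    fix f g :: "'a \<Rightarrow> real" and a b
    assume f: "bounded (range f)"
    then obtain p where p: "\<And>x. \<bar>f x\<bar> \<le> e p x"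
      using dom_bounded by blast
    {
      assume "bounded (range g)"
      then obtain q where "\<And>x. \<bar>g x\<bar> \<le> e q x"
        using dom_bounded by blast
      with p show "\<Lambda> (\<lambda>x. a * f x + b * g x) = a * \<Lambda> f + b * \<Lambda> g"
        by (rule \<Lambda>_comb)
    next
      assume "\<And>x. 0 \<le> f x"
      with p show "0 \<le> \<Lambda> f" by (rule \<Lambda>_nonneg)
    }
  qed
  obtain \<mu> where sets: "sets \<mu> = sets borel" and "finite_measure \<mu>"
    and int_\<mu>: "\<And>f R. continuous_on UNIV f \<Longrightarrow> (\<And>x. R \<le> norm x \<Longrightarrow> f x = 0) \<Longrightarrow> (\<integral>x. f x \<partial>\<mu>) = \<Lambda> f"
    using compactly_supported_representation[OF bounded_functional_axioms] by blast
  interpret finite_measure \<mu> by fact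
  define cut where "cut n x = max 0 (min 1 (real n + 1 - norm x))" for n and x :: 'a
  have cut: "0 \<le> cut n x" "cut n x \<le> 1" "norm x \<le> real n \<Longrightarrow> cut n x = 1" "real n + 1 \<le> norm x \<Longrightarrow> cut n x = 0" for n x
    by (auto simp: cut_def)
  have cut_cont: "continuous_on UNIV (cut n)" for n
    unfolding cut_def by (intro continuous_intros)
  have cut_incseq: "mono (\<lambda>n. cut n x)" for x
    by (rule monoI) (auto simp: cut_def)
  have cut_lim: "(\<lambda>n. cut n x) \<longlonglongrightarrow> 1" for x
  proof (rule tendsto_eventually)
    obtain N where "norm x \<le> real N" using real_arch_simple by blast
    then show "\<forall>\<^sub>F n in sequentially. cut n x = 1"
      by (intro eventually_sequentiallyI[of N] cut(3)) simp
  qed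
  have meas: "f \<in> borel_measurable \<mu>" if "continuous_on UNIV f" for f :: "'a \<Rightarrow> real"
    using borel_measurable_continuous_onI[OF that] sets by (simp cong: measurable_cong_sets)
  have main: "integrable \<mu> (e p) \<and> (\<integral>x. e p x \<partial>\<mu>) = L p" for p
  proof -
    obtain q where q: "\<And>x. (1 + (norm x)\<^sup>2) * \<bar>e p x\<bar> \<le> e q x"
      using growth by blast
    have le: "\<bar>e p x\<bar> \<le> e q x" for x
      using q[of x] mult_right_mono[of 1 "1 + (norm x)\<^sup>2" "\<bar>e p x\<bar>"] by simp
    then have q0: "0 \<le> e q x" for x
      by (meson abs_ge_zero order_trans)
    have le_q: "\<bar>e q x\<bar> \<le> e q x" for x
      using q0[of x] by simp
    have cs: "integrable \<mu> (\<lambda>x. cut n x * f x) \<and> (\<integral>x. cut n x * f x \<partial>\<mu>) = \<Lambda> (\<lambda>x. cut n x * f x)"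
      if "continuous_on UNIV f" for n f
    proof -
      have c: "continuous_on UNIV (\<lambda>x. cut n x * f x)"
        by (intro continuous_intros cut_cont that)
      moreover have z: "cut n x * f x = 0" if "real n + 1 \<le> norm x" for x
        using cut(4)[OF that] by simp
      moreover obtain B where "\<And>x. \<bar>cut n x * f x\<bar> \<le> B"
        using bounded_range_vanishing_at_infinity[OF c z] unfolding bounded_iff by auto
      then have "integrable \<mu> (\<lambda>x. cut n x * f x)"
        by (intro integrable_const_bound[of _ B] meas c) auto
      ultimately show ?thesis
        using int_\<mu>[of "\<lambda>x. cut n x * f x" "real n + 1"] by blast
    qed
    have cont_abs: "continuous_on UNIV (\<lambda>x. \<bar>e p x\<bar>)"
      by (intro continuous_intros cont)
    \<comment> \<open>A bound independent of \<open>n\<close>: with it, monotone convergence of the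
      truncations yields integrability of \<open>e p\<close>.\<close>
    have bound: "(\<integral>x. cut n x * \<bar>e p x\<bar> \<partial>\<mu>) \<le> L q" for n
    proof -
      have 1: "\<bar>cut n x * \<bar>e p x\<bar>\<bar> \<le> e q x" for x
        using mult_mono[OF cut(2) le[of x], of n x] cut(1)[of n x] q0[of x] by (simp add: abs_mult)
      have d: "\<Lambda> (\<lambda>x. 1 * e q x + (- 1) * (cut n x * \<bar>e p x\<bar>)) = 1 * \<Lambda> (e q) + (- 1) * \<Lambda> (\<lambda>x. cut n x * \<bar>e p x\<bar>)"
        by (rule \<Lambda>_comb[OF le_q 1])
      have "0 \<le> \<Lambda> (\<lambda>x. 1 * e q x + (- 1) * (cut n x * \<bar>e p x\<bar>))"
      proof (rule \<Lambda>_nonneg)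
        show "\<bar>1 * e q x + (- 1) * (cut n x * \<bar>e p x\<bar>)\<bar> \<le> e q x" "0 \<le> 1 * e q x + (- 1) * (cut n x * \<bar>e p x\<bar>)" for x
          using 1[of x] cut(1)[of n x] by (auto simp: abs_le_iff)
      qed
      then show ?thesis
        unfolding d using cs[OF cont_abs, of n] by (simp add: \<Lambda>_e)
    qed
    have "incseq (\<lambda>n. \<integral>x. cut n x * \<bar>e p x\<bar> \<partial>\<mu>)"
      using cs[OF cont_abs] cut_incseq
      by (intro incseq_SucI integral_mono) (auto intro!: mult_right_mono dest: incseq_SucD)
    then obtain l where l: "(\<lambda>n. \<integral>x. cut n x * \<bar>e p x\<bar> \<partial>\<mu>) \<longlonglongrightarrow> l"
      using incseq_convergent[of _ "L q"] bound by metis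
    have "integrable \<mu> (\<lambda>x. \<bar>e p x\<bar>)"
    proof (rule integrable_monotone_convergence[OF _ _ _ l])
      show "AE x in \<mu>. mono (\<lambda>n. cut n x * \<bar>e p x\<bar>)"
        using cut_incseq by (intro AE_I2 monoI mult_right_mono) (auto dest: monoD)
      show "AE x in \<mu>. (\<lambda>n. cut n x * \<bar>e p x\<bar>) \<longlonglongrightarrow> \<bar>e p x\<bar>"
        using tendsto_mult_right[OF cut_lim] by (intro AE_I2) fastforce
    qed (use cs[OF cont_abs] meas[OF cont_abs] in auto)
    then have int_p: "integrable \<mu> (e p)"
      using integrable_abs_cancel meas[OF cont] by blast
    have "(\<lambda>n. \<integral>x. cut n x * e p x \<partial>\<mu>) \<longlonglongrightarrow> (\<integral>x. e p x \<partial>\<mu>)"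
    proof (rule integral_dominated_convergence)
      show "integrable \<mu> (\<lambda>x. \<bar>e p x\<bar>)" by fact
      show "AE x in \<mu>. (\<lambda>n. cut n x * e p x) \<longlonglongrightarrow> e p x"
        using tendsto_mult_right[OF cut_lim] by (intro AE_I2) fastforce
      show "AE x in \<mu>. norm (cut n x * e p x) \<le> \<bar>e p x\<bar>" for n
        using cut by (intro AE_I2) (auto simp: abs_mult intro!: mult_left_le_one_le)
    qed (use cs[OF cont] meas[OF cont] in auto)
    moreover have "(\<lambda>n. \<integral>x. cut n x * e p x \<partial>\<mu>) \<longlonglongrightarrow> L p"
    proof (rule LIMSEQ_I)
      \<comment> \<open>Replacing \<open>e p\<close> by its truncation changes
        \<open>\<Lambda>\<close> by at most \<open>L q / (1 + n\<^sup>2)\<close>, since the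
        difference vanishes on the ball of radius \<open>n\<close>.\<close>
      have diff: "\<bar>L p - (\<integral>x. cut n x * e p x \<partial>\<mu>)\<bar> \<le> L q / (1 + (real n)\<^sup>2)" for n
      proof -
        let ?r = "1 / (1 + (real n)\<^sup>2)"
        have pt: "\<bar>e p x - cut n x * e p x\<bar> \<le> ?r * e q x" for x
        proof (cases "norm x \<le> real n")
          case True
          then show ?thesis using cut(3)[OF True] q0 by simp
        next
          case False
          have "\<bar>e p x - cut n x * e p x\<bar> = (1 - cut n x) * \<bar>e p x\<bar>"
            using abs_mult[of "1 - cut n x" "e p x"] cut(2)[of n x] by (simp add: left_diff_distrib)
          also have "\<dots> \<le> \<bar>e p x\<bar>"
            using cut(1)[of n x] cut(2)[of n x] by (intro mult_left_le_one_le) auto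
          also have "(1 + (real n)\<^sup>2) * \<bar>e p x\<bar> \<le> e q x"
            using False q[of x] by (intro order_trans[OF mult_right_mono q[of x]]) auto
          then have "\<bar>e p x\<bar> \<le> ?r * e q x"
            by (simp add: field_simps add_pos_nonneg)
          finally show ?thesis .
        qed
        have dc: "\<bar>cut n x * e p x\<bar> \<le> e q x" for x
          using mult_mono[OF cut(2) le[of x], of n x] cut(1)[of n x] q0[of x] by (simp add: abs_mult)
        have "\<Lambda> (\<lambda>x. 1 * e p x + (- 1) * (cut n x * e p x)) = 1 * \<Lambda> (e p) + (- 1) * \<Lambda> (\<lambda>x. cut n x * e p x)"
          by (rule \<Lambda>_comb[OF le dc])
        then have *: "\<Lambda> (\<lambda>x. e p x - cut n x * e p x) = L p - (\<integral>x. cut n x * e p x \<partial>\<mu>)"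
          using cs[OF cont, of n p] by (simp add: \<Lambda>_e)
        have dd: "\<bar>e p x - cut n x * e p x\<bar> \<le> e (?r *\<^sub>R q) x" for x
          using pt[of x] linear_scale[OF e, of ?r q x] by simp
        \<comment> \<open>The signs \<open>a = 1\<close> and \<open>a = -1\<close> give the two
          halves of the absolute value estimate.\<close>
        have pm: "0 \<le> ?r * L q + a * (L p - (\<integral>x. cut n x * e p x \<partial>\<mu>))" if "\<bar>a\<bar> = 1" for a
        proof -
          have eq: "\<Lambda> (\<lambda>x. ?r * e q x + a * (e p x - cut n x * e p x)) =
              ?r * \<Lambda> (e q) + a * \<Lambda> (\<lambda>x. e p x - cut n x * e p x)"
            by (rule \<Lambda>_comb[OF le_q dd])
          have a: "\<bar>a * (e p x - cut n x * e p x)\<bar> \<le> ?r * e q x" for x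
            unfolding abs_mult that using pt by simp
          have "0 \<le> \<Lambda> (\<lambda>x. ?r * e q x + a * (e p x - cut n x * e p x))"
          proof (rule \<Lambda>_nonneg)
            \<comment> \<open>The factor 2 arises because both summands are bounded by
              \<open>?r * e q x\<close>.\<close>
            show "\<bar>?r * e q x + a * (e p x - cut n x * e p x)\<bar> \<le> e ((2 * ?r) *\<^sub>R q) x" for x
              using a[of x] linear_scale[OF e, of "2 * ?r" q x] by simp
            show "0 \<le> ?r * e q x + a * (e p x - cut n x * e p x)" for x
              using a[of x] by (simp add: abs_le_iff)
          qed
          then show ?thesis unfolding eq * \<Lambda>_e .
        qed
        show ?thesis
          using pm[of 1] pm[of "-1"] by (simp add: abs_le_iff)
      qed
      fix \<epsilon> :: real assume "\<epsilon> > 0"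
      have "(\<lambda>n. L q / (1 + (real n)\<^sup>2)) \<longlonglongrightarrow> 0"
        by real_asymp
      from LIMSEQ_D[OF this \<open>\<epsilon> > 0\<close>] obtain N where N: "\<And>n. n \<ge> N \<Longrightarrow> \<bar>L q / (1 + (real n)\<^sup>2)\<bar> < \<epsilon>"
        by auto
      show "\<exists>N. \<forall>n\<ge>N. norm ((\<integral>x. cut n x * e p x \<partial>\<mu>) - L p) < \<epsilon>"
      proof (intro exI[of _ N] allI impI)
        fix n assume "n \<ge> N"
        from N[OF this] diff[of n] show "norm ((\<integral>x. cut n x * e p x \<partial>\<mu>) - L p) < \<epsilon>"
          unfolding real_norm_def by linarith
      qed
    qed
    ultimately have "(\<integral>x. e p x \<partial>\<mu>) = L p"
      by (rule LIMSEQ_unique)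
    with int_p show ?thesis by blast
  qed
  show ?thesis
    by (rule that[of \<mu>]) (use sets main in auto)
qed

section \<open>Real parts of quaternionic polynomials\<close>

lemma continuous_on_qcnj [continuous_intros]:
  "continuous_on S f \<Longrightarrow> continuous_on S (\<lambda>x. qcnj (f x))"
  by (rule bounded_linear.continuous_on[OF linear_conv_bounded_linear[THEN iffD1, OF linear_qcnj]])

lemma linear_qre: "linear qre"
  by (rule linearI) (simp_all add: plus_quat_def scaleR_quat_def)

lemma continuous_on_qre [continuous_intros]:
  "continuous_on S f \<Longrightarrow> continuous_on S (\<lambda>x. qre (f x))"
  by (rule bounded_linear.continuous_on[OF linear_conv_bounded_linear[THEN iffD1, OF linear_qre]])

lemma continuous_on_list_eval: "continuous_on UNIV (\<lambda>a. list_eval a u)"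
proof (induction u)
  case (Cons x u)
  have "continuous_on UNIV (\<lambda>a. letter_eval a x)"
    by (cases x) (auto intro!: continuous_intros)
  with Cons show ?case
    by (auto simp: list_eval_def intro!: continuous_intros)
qed (simp add: list_eval_def)

lemma continuous_on_word_eval: "continuous_on UNIV (\<lambda>a. word_eval a w)"
  by transfer (rule continuous_on_list_eval)

lemma continuous_on_poly_eval: "continuous_on UNIV (\<lambda>a. poly_eval a p)"
  unfolding poly_eval_def lin_ext_def by (intro continuous_intros continuous_on_word_eval)

lemma qre_of_real [simp]: "qre (of_real r) = r"
  by (simp add: of_real_def one_quat_def scaleR_quat_def)

lemma half_plus_qcnj: "(1 / 2) *\<^sub>R (p + qcnj p) = of_real (qre p)"
  by (simp add: quat_eq_iff quat_defs of_real_def)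

section \<open>Symmetric parts and positivity\<close>

definition sym_part :: "'n qpoly \<Rightarrow> 'n qpoly" where
  "sym_part p = (1 / 2) *\<^sub>R (p + poly_star p)"

lemma sym_part_in_Sym: "sym_part p \<in> Sym"
  by (simp add: sym_part_def Sym_def linear_scale[OF linear_poly_star] linear_add[OF linear_poly_star]
      add.commute)

lemma sym_part_Sym: "p \<in> Sym \<Longrightarrow> sym_part p = p"
  by (simp add: sym_part_def Sym_def scaleR_add_right flip: scaleR_add_left)

lemma poly_eval_sym_part: "poly_eval a (sym_part p) = of_real (qre (poly_eval a p))"
  by (simp add: sym_part_def linear_scale[OF linear_poly_eval] linear_add[OF linear_poly_eval]
      poly_eval_star half_plus_qcnj)

lemma quat_nonneg_of_real [simp]: "quat_nonneg (of_real r) \<longleftrightarrow> 0 \<le> r"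
  by (simp add: quat_nonneg_def)

text \<open>Translates the cone of symmetric nonnegative polynomials into a condition on real parts
  of arbitrary polynomials, the form in which Haviland's argument applies.\<close>

lemma sym_part_in_nonneg_polys: "sym_part p \<in> nonneg_polys \<longleftrightarrow> (\<forall>a. 0 \<le> qre (poly_eval a p))"
  by (simp add: nonneg_polys_def sym_part_in_Sym poly_eval_sym_part)

lemma linear_riesz: "linear (riesz y)"
  unfolding riesz_def by (rule linear_lin_ext)

lemma riesz_poly_star:
  assumes "pseudo_moment_seq y"
  shows "riesz y (poly_star p) = riesz y p"
  by (rule linear_poly_mapping_ext[OF
        linear_compose[OF linear_poly_star linear_riesz, unfolded comp_def] linear_riesz])
    (use assms in \<open>simp add: poly_star_def riesz_def pseudo_moment_seq_def\<close>)

lemma riesz_sym_part: "pseudo_moment_seq y \<Longrightarrow> riesz y (sym_part p) = riesz y p"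
  by (simp add: sym_part_def linear_scale[OF linear_riesz] linear_add[OF linear_riesz] riesz_poly_star)

text \<open>A polynomial that vanishes everywhere is nonnegative together with its negative, so
  \<open>riesz y\<close> kills it. Once the ideal is killed, the induced functional at the class of
  \<open>p\<close> is \<open>riesz y (sym_part p)\<close>, which equals \<open>riesz y p\<close>;
  positivity then passes both ways.\<close>

lemma riesz_nonneg_iff_quotient:
  fixes y :: "'n::finite qword \<Rightarrow> real"
  assumes y: "pseudo_moment_seq y"
  shows "(\<forall>p\<in>nonneg_polys. 0 \<le> riesz y p) \<longleftrightarrow>
         (\<forall>p\<in>vanishing_ideal. riesz y p = 0) \<and>
         (\<forall>b\<in>Sym_alg. (\<forall>a. quat_nonneg (alg_eval a b)) \<longrightarrow> 0 \<le> induced_riesz y b)"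
    (is "?P \<longleftrightarrow> ?V \<and> ?Q")
proof
  assume P: ?P
  have nn: "0 \<le> riesz y p" if "\<And>a. 0 \<le> qre (poly_eval a p)" for p
    using P that riesz_sym_part[OF y, of p] by (metis sym_part_in_nonneg_polys)
  have V: ?V
  proof
    fix p :: "'n qpoly" assume "p \<in> vanishing_ideal"
    then have "poly_eval a p = 0" for a
      by (simp add: vanishing_ideal_def)
    then have "0 \<le> riesz y p" "0 \<le> riesz y (- p)"
      by (auto intro!: nn simp: linear_neg[OF linear_poly_eval] zero_quat_def uminus_quat_def)
    then show "riesz y p = 0"
      by (simp add: linear_neg[OF linear_riesz])
  qed
  have ?Q
  proof (intro ballI impI)
    fix b :: "'n scalar_alg" assume b: "\<forall>a. quat_nonneg (alg_eval a b)"
    have "\<exists>p. b = alg_class p"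
      unfolding alg_class_def by (induction b rule: scalar_alg.abs_induct) blast
    then obtain p where p: "b = alg_class p" by blast
    have "0 \<le> riesz y p"
      using b by (intro nn) (simp add: p alg_class_def alg_eval.abs_eq quat_nonneg_def)
    then show "0 \<le> induced_riesz y b"
      using riesz_sym_part[OF y, of p] by (simp add: p induced_riesz_alg_class[OF V] sym_part_def)
  qed
  with V show "?V \<and> ?Q" by blast
next
  assume *: "?V \<and> ?Q"
  show ?P
  proof
    fix p :: "'n qpoly" assume p: "p \<in> nonneg_polys"
    then have "p \<in> Sym" by (simp add: nonneg_polys_def)
    then have "alg_class p \<in> Sym_alg"
      by (simp add: Sym_alg_def Sym_def alg_class_def alg_star.abs_eq)
    moreover have "\<forall>a. quat_nonneg (alg_eval a (alg_class p))"
      using p by (simp add: nonneg_polys_def alg_class_def alg_eval.abs_eq)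
    ultimately have "0 \<le> induced_riesz y (alg_class p)"
      using * by blast
    also have "\<dots> = riesz y (sym_part p)"
      using * by (simp add: induced_riesz_alg_class sym_part_def)
    finally show "0 \<le> riesz y p"
      by (simp add: sym_part_Sym[OF \<open>p \<in> Sym\<close>])
  qed
qed

text \<open>Summing the moments of the words turns \<open>riesz y p\<close> into the integral of the
  real part of \<open>p\<close>.\<close>

lemma represents_imp_riesz_nonneg:
  assumes "represents \<mu> y" "p \<in> nonneg_polys"
  shows "0 \<le> riesz y p"
proof -
  have int: "integrable \<mu> (\<lambda>a. qre (word_eval a w))" "y w = (\<integral>a. qre (word_eval a w) \<partial>\<mu>)" for w
    using assms(1) by (auto simp: represents_def)
  have "riesz y p = (\<Sum>w\<in>Poly_Mapping.keys p. Poly_Mapping.lookup p w * y w)"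
    by (simp add: riesz_def lin_ext_def)
  also have "\<dots> = (\<integral>a. (\<Sum>w\<in>Poly_Mapping.keys p. Poly_Mapping.lookup p w * qre (word_eval a w)) \<partial>\<mu>)"
    using int by simp
  also have "\<dots> = (\<integral>a. qre (poly_eval a p) \<partial>\<mu>)"
    by (simp add: poly_eval_def lin_ext_def linear_sum[OF linear_qre] linear_scale[OF linear_qre])
  also have "\<dots> \<ge> 0"
    using assms(2) by (intro integral_nonneg_AE AE_I2) (simp add: nonneg_polys_def quat_nonneg_def)
  finally show ?thesis .
qed

definition norm_square_poly :: "'n::finite qpoly" where
  "norm_square_poly = (\<Sum>i\<in>UNIV. Poly_Mapping.single (abs_qword [Var i, Bar i]) 1)"

lemma poly_eval_norm_square_poly: "poly_eval a norm_square_poly = of_real ((norm a)\<^sup>2)"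
proof -
  have "poly_eval a norm_square_poly = (\<Sum>i\<in>UNIV. of_real ((norm (a $ i))\<^sup>2))"
    unfolding norm_square_poly_def linear_sum[OF linear_poly_eval]
    by (simp add: poly_eval_def word_eval.abs_eq list_eval_def mult_qcnj)
  also have "\<dots> = of_real ((norm a)\<^sup>2)"
    by (simp add: norm_vec_def L2_set_def sum_nonneg)
  finally show ?thesis .
qed

lemma poly_growth:
  fixes p :: "'n::finite qpoly"
  shows "\<exists>q. \<forall>a. (1 + (norm a)\<^sup>2) * \<bar>qre (poly_eval a p)\<bar> \<le> qre (poly_eval a q)"
proof (intro exI allI)
  fix a :: "quat ^ 'n"
  let ?r = "qre (poly_eval a p)"
  \<comment> \<open>The dominating polynomial is \<open>(1 + |q|\<^sup>2) (1 + r\<^sup>2)\<close>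
    with \<open>r\<close> the real part of \<open>p\<close>, realised by \<open>sym_part p\<close>.
    All factors evaluate to reals, and \<open>1 + r\<^sup>2\<close> replaces the absolute value of
    \<open>r\<close>, which need not be polynomial.\<close>
  have "poly_eval a ((1 + norm_square_poly) * (1 + sym_part p * sym_part p))
      = of_real ((1 + (norm a)\<^sup>2) * (1 + ?r * ?r))"
    by (simp only: poly_eval_mult linear_add[OF linear_poly_eval] poly_eval_norm_square_poly
        poly_eval_sym_part poly_eval_1 of_real_mult of_real_add of_real_1)
  moreover have "\<bar>?r\<bar> \<le> 1 + ?r * ?r"
  proof -
    have "0 \<le> (\<bar>?r\<bar> - 1)\<^sup>2" by simp
    then have "2 * \<bar>?r\<bar> \<le> 1 + ?r * ?r"
      by (simp add: power2_eq_square algebra_simps)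
    then show ?thesis by simp
  qed
  ultimately show "(1 + (norm a)\<^sup>2) * \<bar>?r\<bar>
      \<le> qre (poly_eval a ((1 + norm_square_poly) * (1 + sym_part p * sym_part p)))"
    by (simp only: qre_of_real) (intro mult_left_mono; simp)
qed

lemma riesz_nonneg_imp_represents:
  fixes y :: "'n::finite qword \<Rightarrow> real"
  assumes y: "pseudo_moment_seq y" and nn: "\<forall>p\<in>nonneg_polys. 0 \<le> riesz y p"
  shows "\<exists>\<mu>. represents \<mu> y"
proof -
  let ?e = "\<lambda>(p :: 'n qpoly) a. qre (poly_eval a p)"
  have lin: "linear (\<lambda>p. ?e p a)" for a :: "quat ^ 'n"
    using linear_compose[OF linear_poly_eval linear_qre] by (simp add: comp_def)
  have cont: "continuous_on UNIV (?e p)" for p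
    by (intro continuous_intros continuous_on_poly_eval)
  have one: "?e 1 a = 1" for a
    by (simp add: one_quat_def)
  have pos: "0 \<le> riesz y p" if "\<And>a. 0 \<le> ?e p a" for p
    using nn that riesz_sym_part[OF y, of p] by (metis sym_part_in_nonneg_polys)
  obtain \<mu> where \<mu>: "sets \<mu> = sets borel" "\<And>p. integrable \<mu> (?e p)" "\<And>p. (\<integral>a. ?e p a \<partial>\<mu>) = riesz y p"
    using adapted_Haviland[of ?e 1 "riesz y", OF lin cont one poly_growth linear_riesz pos] by metis
  have "represents \<mu> y"
    unfolding represents_def
  proof (intro conjI allI)
    fix w
    have e: "?e (Poly_Mapping.single w 1) = (\<lambda>a. qre (word_eval a w))"
      by (simp add: poly_eval_def)
    show "integrable \<mu> (\<lambda>a. qre (word_eval a w))"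
      using \<mu>(2)[of "Poly_Mapping.single w 1"] unfolding e .
    show "y w = (\<integral>a. qre (word_eval a w) \<partial>\<mu>)"
      using \<mu>(3)[of "Poly_Mapping.single w 1"] unfolding e by (simp add: riesz_def)
  qed (rule \<mu>(1))
  then show ?thesis ..
qed

section \<open>Averaging over unit quaternions\<close>

text \<open>An orthogonal \<open>T\<close> maps the ball to itself and preserves volume. The
  comparison goes through Lebesgue measure, which agrees with \<open>lborel\<close> on Borel
  sets.\<close>

lemma distr_uniform_ball_orthogonal:
  fixes T :: "real ^ 'm::{finite,wellorder} \<Rightarrow> real ^ 'm::_"
  assumes T: "orthogonal_transformation T"
  shows "distr (uniform_measure lborel (ball 0 1)) borel T = uniform_measure lborel (ball 0 1)"
    (is "distr ?\<kappa> _ _ = _")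
proof (rule measure_eqI)
  fix A assume "A \<in> sets (distr ?\<kappa> borel T)"
  then have A: "A \<in> sets borel" by simp
  have cont: "continuous_on UNIV T"
    by (intro linear_continuous_on linear_conv_bounded_linear[THEN iffD1]
        orthogonal_transformation_linear T)
  then have [measurable]: "T \<in> borel_measurable borel"
    by (rule borel_measurable_continuous_onI)
  have TA: "T -` A \<in> sets borel"
    using measurable_sets_borel[OF \<open>T \<in> borel_measurable borel\<close> A] by simp
  have "bij T"
    by (rule orthogonal_transformation_bij[OF T])
  have "T ` (ball 0 1 \<inter> T -` A) = ball 0 1 \<inter> A"
  proof (intro equalityI subsetI)
    fix x assume "x \<in> ball 0 1 \<inter> A"
    moreover obtain z where "x = T z"
      using \<open>bij T\<close> by (metis bij_pointE)
    ultimately show "x \<in> T ` (ball 0 1 \<inter> T -` A)"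
      using orthogonal_transformation_norm[OF T, of z] by auto
  qed (use orthogonal_transformation_norm[OF T] in auto)
  moreover have "ball 0 1 \<inter> T -` A \<in> lmeasurable" "ball 0 1 \<inter> A \<in> lmeasurable"
    using A TA by (auto intro!: fmeasurable.Int bounded_set_imp_lmeasurable bounded_Int)
  ultimately have "measure lebesgue (ball 0 1 \<inter> T -` A) = measure lebesgue (ball 0 1 \<inter> A)"
    using measure_orthogonal_image[OF T] by metis
  then have "emeasure lborel (ball 0 1 \<inter> T -` A) = emeasure lborel (ball 0 1 \<inter> A)"
    using A TA emeasure_bounded_finite[OF bounded_Int[OF disjI1[OF bounded_ball]]]
    by (subst (1 2) emeasure_eq_ennreal_measure) (auto simp: measure_completion less_top)
  then show "emeasure (distr ?\<kappa> borel T) A = emeasure ?\<kappa> A"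
    using A TA by (simp add: emeasure_distr)
qed simp

section \<open>Quaternions as vectors in four-dimensional space\<close>

definition quat_of_vec :: "real ^ 4 \<Rightarrow> quat" where
  "quat_of_vec v = Quat (v $ 1) (v $ 2) (v $ 3) (v $ 4)"

definition vec_of_quat :: "quat \<Rightarrow> real ^ 4" where
  "vec_of_quat p = vector [qre p, qim1 p, qim2 p, qim3 p]"

lemma vector_4: "(vector [a, b, c, d] :: real ^ 4) $ 1 = a" "(vector [a, b, c, d] :: real ^ 4) $ 2 = b"
  "(vector [a, b, c, d] :: real ^ 4) $ 3 = c" "(vector [a, b, c, d] :: real ^ 4) $ 4 = d"
  unfolding vector_def by simp_all

lemma quat_of_vec_of_quat [simp]: "quat_of_vec (vec_of_quat p) = p"
  by (simp add: quat_of_vec_def vec_of_quat_def vector_4)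

lemma linear_quat_of_vec: "linear quat_of_vec"
  by (rule linearI) (simp_all add: quat_of_vec_def plus_quat_def scaleR_quat_def)

lemma norm_quat_of_vec [simp]: "norm (quat_of_vec v) = norm v"
  by (simp add: quat_of_vec_def norm_quat_def inner_quat_def norm_eq_sqrt_inner[of v] inner_vec_def sum_4)

lemma norm_vec_of_quat [simp]: "norm (vec_of_quat p) = norm p"
  using norm_quat_of_vec[of "vec_of_quat p"] by simp

lemma linear_vec_of_quat: "linear vec_of_quat"
  by (rule linearI) (simp_all add: vec_of_quat_def vec_eq_iff forall_4 vector_4 plus_quat_def scaleR_quat_def)

definition quat_rotation :: "quat \<Rightarrow> real ^ 4 \<Rightarrow> real ^ 4" where
  "quat_rotation u v = vec_of_quat (u * quat_of_vec v)"

text \<open>The quaternion norm is multiplicative, so left multiplication by a unit is a linear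
  isometry.\<close>

lemma orthogonal_quat_rotation:
  assumes "norm u = 1"
  shows "orthogonal_transformation (quat_rotation u)"
  unfolding orthogonal_transformation
proof
  have "linear ((*) u)"
    by (rule linearI) (simp_all add: distrib_left)
  from linear_compose[OF linear_compose[OF linear_quat_of_vec this] linear_vec_of_quat]
  show "linear (quat_rotation u)"
    by (simp add: quat_rotation_def[abs_def] comp_def)
qed (simp add: quat_rotation_def norm_mult assms)

section \<open>Simultaneous conjugation of words\<close>

lemma norm_1_mult_qcnj:
  assumes "norm u = 1"
  shows "qcnj u * u = 1" "u * qcnj u = 1"
  using assms by (simp_all add: mult_qcnj qcnj_mult_self)

text \<open>Each letter is conjugated by \<open>u\<close>, barred ones included, and the inner
  factors \<open>qcnj u * u\<close> between neighbouring letters cancel.\<close>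

lemma list_eval_quat_conj:
  assumes u: "norm u = 1"
  shows "list_eval (quat_conj u a) w = u * list_eval a w * qcnj u"
proof (induction w)
  case (Cons x w)
  have "letter_eval (quat_conj u a) x = u * letter_eval a x * qcnj u"
    by (cases x) (simp_all add: quat_conj_def qcnj_mult mult.assoc)
  then have "list_eval (quat_conj u a) (x # w) = u * letter_eval a x * (qcnj u * u) * list_eval a w * qcnj u"
    using Cons by (simp add: list_eval_def mult.assoc)
  then show ?case
    by (simp add: norm_1_mult_qcnj[OF u] list_eval_def mult.assoc)
qed (simp add: list_eval_def norm_1_mult_qcnj[OF u])

lemma word_eval_quat_conj:
  "norm u = 1 \<Longrightarrow> word_eval (quat_conj u a) w = u * word_eval a w * qcnj u"
  by transfer (rule list_eval_quat_conj)

lemma qre_mult_commute: "qre (p * q) = qre (q * p)"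
  by (simp add: times_quat_def)

text \<open>The real part is a trace: by \<open>qre_mult_commute\<close> the factor
  \<open>qcnj u\<close> moves to the front, where it cancels \<open>u\<close>.\<close>

lemma qre_word_eval_quat_conj:
  assumes "norm u = 1"
  shows "qre (word_eval (quat_conj u a) w) = qre (word_eval a w)"
  using assms
  by (simp add: word_eval_quat_conj qre_mult_commute[of _ "qcnj u"] norm_1_mult_qcnj flip: mult.assoc)

lemma quat_conj_quat_conj: "quat_conj u (quat_conj v a) = quat_conj (u * v) a"
  by (simp add: quat_conj_def vec_eq_iff qcnj_mult mult.assoc)

lemma sgn_mult_unit: "norm (u::quat) = 1 \<Longrightarrow> sgn (u * v) = u * sgn v"
  by (simp add: sgn_quat_def norm_mult)

text \<open>The new measure is the law of \<open>a\<close> conjugated by \<open>v / |v|\<close>,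
  where \<open>v\<close> is independent of \<open>a\<close> and uniform in the unit ball. Every
  outcome has the same real parts of words as \<open>a\<close>, so the moments persist; conjugating
  further by \<open>u\<close> amounts to rotating \<open>v\<close>, which does not change its
  law.\<close>

lemma represents_conj_invariant:
  fixes \<mu> :: "(quat ^ 'n::finite) measure"
  assumes \<mu>: "represents \<mu> y"
  shows "\<exists>\<mu>'. represents \<mu>' y \<and> conj_invariant \<mu>'"
proof -
  have sets_\<mu>: "sets \<mu> = sets borel"
    and int: "\<And>w. integrable \<mu> (\<lambda>a. qre (word_eval a w))" "\<And>w. y w = (\<integral>a. qre (word_eval a w) \<partial>\<mu>)"
    using \<mu> by (auto simp: represents_def)
  \<comment> \<open>The empty word evaluates to 1, so its moment is the total mass.\<close>
  have "integrable \<mu> (\<lambda>a. 1 :: real)"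
    using int(1)[of 0] by (simp add: one_quat_def)
  then interpret \<mu>: finite_measure \<mu>
    by (intro finite_measureI) (simp add: integrable_iff_bounded)
  define \<kappa> :: "(real ^ 4) measure" where "\<kappa> = uniform_measure lborel (ball 0 1)"
  have sets_\<kappa>: "sets \<kappa> = sets borel"
    by (simp add: \<kappa>_def)
  interpret \<kappa>: prob_space \<kappa>
    unfolding \<kappa>_def
  proof (rule prob_space_uniform_measure)
    show "emeasure lborel (ball (0 :: real ^ 4) 1) \<noteq> 0"
      using content_ball_pos[of 1 "0 :: real ^ 4"] by (auto simp: measure_def)
    show "emeasure lborel (ball (0 :: real ^ 4) 1) \<noteq> \<infinity>"
      using emeasure_lborel_ball_finite[of "0 :: real ^ 4" 1] by simp
  qed
  interpret pair_sigma_finite \<mu> \<kappa> ..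
  define \<Phi> where "\<Phi> = (\<lambda>(a :: quat ^ 'n, v). quat_conj (sgn (quat_of_vec v)) a)"
  have sets_pair: "sets (\<mu> \<Otimes>\<^sub>M \<kappa>) = sets (borel \<Otimes>\<^sub>M borel)"
    by (rule sets_pair_measure_cong[OF sets_\<mu> sets_\<kappa>])
  have \<Phi>: "\<Phi> \<in> borel_measurable (\<mu> \<Otimes>\<^sub>M \<kappa>)"
  proof -
    have "continuous_on UNIV (\<lambda>(u, a :: quat ^ 'n). quat_conj u a)"
      unfolding quat_conj_def case_prod_beta by (intro continuous_intros)
    then have 1: "(\<lambda>(u, a :: quat ^ 'n). quat_conj u a) \<in> borel_measurable (borel \<Otimes>\<^sub>M borel)"
      by (simp add: borel_measurable_continuous_onI borel_prod)
    have "continuous_on UNIV quat_of_vec"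
      by (simp add: linear_quat_of_vec linear_continuous_on linear_conv_bounded_linear[symmetric])
    then have [measurable]: "quat_of_vec \<in> borel_measurable borel"
      by (rule borel_measurable_continuous_onI)
    have [measurable]: "(\<lambda>v. sgn (quat_of_vec v)) \<in> borel_measurable borel"
      unfolding sgn_quat_def by measurable
    have "(\<lambda>(a :: quat ^ 'n, v). (sgn (quat_of_vec v), a)) \<in> borel \<Otimes>\<^sub>M borel \<rightarrow>\<^sub>M borel \<Otimes>\<^sub>M borel"
      by measurable
    from measurable_compose[OF this 1] show ?thesis
      unfolding measurable_cong_sets[OF sets_pair refl] by (simp add: \<Phi>_def case_prod_beta)
  qed
  define \<mu>' where "\<mu>' = distr (\<mu> \<Otimes>\<^sub>M \<kappa>) borel \<Phi>"
  \<comment> \<open>At \<open>v = 0\<close> the direction \<open>sgn\<close> has the default value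
    0, which is no unit, and \<open>\<Phi>\<close> collapses \<open>a\<close> to 0. This happens
    only on a null set.\<close>
  have "AE v in \<kappa>. v \<noteq> 0"
    unfolding \<kappa>_def
    by (rule AE_uniform_measureI) (auto intro: AE_mp[OF AE_lborel_singleton])
  moreover have snd_nz: "{x \<in> space (\<mu> \<Otimes>\<^sub>M \<kappa>). snd x \<noteq> 0} \<in> sets (\<mu> \<Otimes>\<^sub>M \<kappa>)"
  proof -
    have [measurable]: "snd \<in> borel_measurable (\<mu> \<Otimes>\<^sub>M \<kappa>)"
      using measurable_snd[of \<mu> \<kappa>] measurable_cong_sets[OF refl sets_\<kappa>] by blast
    show ?thesis by measurable
  qed
  ultimately have "AE x in \<mu> \<Otimes>\<^sub>M \<kappa>. snd x \<noteq> 0"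
    by (intro AE_pair_measure snd_nz) simp
  then have ae: "AE x in \<mu> \<Otimes>\<^sub>M \<kappa>. qre (word_eval (\<Phi> x) w) = qre (word_eval (fst x) w)" for w
  proof eventually_elim
    case (elim x)
    have "quat_of_vec (snd x) \<noteq> 0"
      using elim by (metis norm_eq_zero norm_quat_of_vec)
    then have "norm (sgn (quat_of_vec (snd x))) = 1"
      by (simp add: norm_sgn)
    then show ?case
      by (simp add: \<Phi>_def case_prod_beta qre_word_eval_quat_conj)
  qed
  have "represents \<mu>' y"
    unfolding represents_def
  proof (intro conjI allI)
    fix w :: "'n qword"
    let ?f = "\<lambda>a. qre (word_eval a w)"
    have f: "?f \<in> borel_measurable borel"
      by (intro borel_measurable_continuous_onI continuous_intros continuous_on_word_eval)
    have f\<mu>: "?f \<in> borel_measurable \<mu>"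
      using int(1) by (rule borel_measurable_integrable)
    have f\<Phi>: "(\<lambda>x. ?f (\<Phi> x)) \<in> borel_measurable (\<mu> \<Otimes>\<^sub>M \<kappa>)"
      by (rule measurable_compose[OF \<Phi> f])
    have ffst: "(\<lambda>x. ?f (fst x)) \<in> borel_measurable (\<mu> \<Otimes>\<^sub>M \<kappa>)"
      by (rule measurable_compose[OF measurable_fst f\<mu>])
    \<comment> \<open>The total mass of \<open>\<kappa>\<close> is 1, so the first marginal of the
      product is \<open>\<mu>\<close> itself.\<close>
    have "integrable (distr (\<mu> \<Otimes>\<^sub>M \<kappa>) \<mu> fst) ?f"
      using int(1) by (simp add: \<kappa>.distr_pair_fst)
    then have "integrable (\<mu> \<Otimes>\<^sub>M \<kappa>) (\<lambda>x. ?f (fst x))"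
      by (rule integrable_distr[OF measurable_fst])
    then show "integrable \<mu>' ?f"
      unfolding \<mu>'_def using ae by (simp add: integrable_distr_eq[OF \<Phi> f] integrable_cong_AE[OF f\<Phi> ffst])
    have "(\<integral>a. ?f a \<partial>\<mu>') = (\<integral>x. ?f (fst x) \<partial>(\<mu> \<Otimes>\<^sub>M \<kappa>))"
      unfolding \<mu>'_def integral_distr[OF \<Phi> f] by (rule integral_cong_AE[OF f\<Phi> ffst ae])
    also have "\<dots> = (\<integral>a. ?f a \<partial>(distr (\<mu> \<Otimes>\<^sub>M \<kappa>) \<mu> fst))"
      by (rule integral_distr[OF measurable_fst f\<mu>, symmetric])
    also have "\<dots> = y w"
      by (simp add: \<kappa>.distr_pair_fst int(2))
    finally show "y w = (\<integral>a. ?f a \<partial>\<mu>')" ..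
  qed (simp add: \<mu>'_def)
  moreover have "conj_invariant \<mu>'"
    unfolding conj_invariant_def
  proof (intro allI impI)
    fix u :: quat assume u: "norm u = 1"
    let ?T = "quat_rotation u"
    have T: "distr \<kappa> \<kappa> ?T = \<kappa>"
      using distr_uniform_ball_orthogonal[OF orthogonal_quat_rotation[OF u]] sets_\<kappa>
      unfolding \<kappa>_def by (metis distr_cong)
    have [measurable]: "?T \<in> \<kappa> \<rightarrow>\<^sub>M \<kappa>"
      unfolding measurable_cong_sets[OF sets_\<kappa> sets_\<kappa>]
      using orthogonal_quat_rotation[OF u]
      by (intro borel_measurable_continuous_onI linear_continuous_on)
        (simp add: orthogonal_transformation_linear linear_conv_bounded_linear[symmetric])
    have pair: "distr (\<mu> \<Otimes>\<^sub>M \<kappa>) (\<mu> \<Otimes>\<^sub>M \<kappa>) (\<lambda>(a, v). (a, ?T v)) = \<mu> \<Otimes>\<^sub>M \<kappa>"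
      using pair_measure_distr[of "\<lambda>a. a" \<mu> \<mu> ?T \<kappa> \<kappa>] T \<kappa>.sigma_finite_measure_axioms
      by (simp add: distr_id)
    have "distr \<mu>' borel (quat_conj u) = distr (\<mu> \<Otimes>\<^sub>M \<kappa>) borel (quat_conj u \<circ> \<Phi>)"
      unfolding \<mu>'_def by (rule distr_distr[OF quat_conj_measurable \<Phi>])
    \<comment> \<open>Equivariance of \<open>\<Phi>\<close>: taking directions commutes with left
      multiplication by a unit. This holds at \<open>v = 0\<close> as well, so the identity is exact
      and not just almost everywhere.\<close>
    also have "quat_conj u \<circ> \<Phi> = \<Phi> \<circ> (\<lambda>(a, v). (a, ?T v))"
      by (auto simp: fun_eq_iff \<Phi>_def quat_conj_quat_conj quat_rotation_def sgn_mult_unit[OF u])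
    also have "distr (\<mu> \<Otimes>\<^sub>M \<kappa>) borel \<dots> = distr (distr (\<mu> \<Otimes>\<^sub>M \<kappa>) (\<mu> \<Otimes>\<^sub>M \<kappa>) (\<lambda>(a, v). (a, ?T v))) borel \<Phi>"
      by (rule distr_distr[OF \<Phi>, symmetric]) measurable
    also have "\<dots> = \<mu>'"
      unfolding pair \<mu>'_def ..
    finally show "distr \<mu>' borel (quat_conj u) = \<mu>'" .
  qed
  ultimately show ?thesis by blast
qed

theorem theorem5p1:
  fixes y :: "'n::finite qword \<Rightarrow> real"
  assumes "pseudo_moment_seq y"
  shows "((\<exists>\<mu>. represents \<mu> y) \<longleftrightarrow> (\<forall>p\<in>nonneg_polys. 0 \<le> riesz y p))
    \<and> ((\<forall>p\<in>nonneg_polys. 0 \<le> riesz y p) \<longleftrightarrow>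
         (\<forall>p\<in>vanishing_ideal. riesz y p = 0) \<and>
         (\<forall>b\<in>Sym_alg. (\<forall>a. quat_nonneg (alg_eval a b)) \<longrightarrow> 0 \<le> induced_riesz y b))
    \<and> ((\<exists>\<mu>. represents \<mu> y) \<longrightarrow> (\<exists>\<mu>. represents \<mu> y \<and> conj_invariant \<mu>))"
  using represents_imp_riesz_nonneg riesz_nonneg_imp_represents[OF assms]
    riesz_nonneg_iff_quotient[OF assms] represents_conj_invariant by blast

end
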